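(* Let $v \ge 4$ be an integer with $v \equiv 1$ or $4 \pmod{12}$ and $v \ne 13$. Then \[ \beta\left( \left\lfloor \frac{v}{4} \right\rfloor, v, 4 \right) = \frac{v(v-1)}{12}. \]
   Context: For integers $v \ge k \ge 2$, a $(v,k)$-packing is a pair $(X,\mathcal{B})$ where $X$ is a set of $v$ points and $\mathcal{B}$ is a set of $k$-subsets of $X$ (blocks) such that every pair of distinct points lies in at most one block. A partial parallel class (PPC) is a set of pairwise disjoint blocks; its size is the number of blocks. A PPC of size $\rho$ is maximum if the packing has no PPC of size $\rho+1$. $\beta(\rho,v,k)$ denotes the maximum number of blocks in a $(v,k)$-packing in which the maximum PPC has size $\rho$. *)

theory Defs
  imports Main
begin

definition packing :: "nat \<Rightarrow> nat \<Rightarrow> nat set set \<Rightarrow> bool" where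
  "packing v k \<B> \<longleftrightarrow>
     (\<forall>B\<in>\<B>. B \<subseteq> {..<v} \<and> card B = k) \<and>
     (\<forall>x<v. \<forall>y<v. x \<noteq> y \<longrightarrow> card {B\<in>\<B>. x \<in> B \<and> y \<in> B} \<le> 1)"

definition ppc :: "nat set set \<Rightarrow> nat set set \<Rightarrow> bool" where
  "ppc \<B> P \<longleftrightarrow> P \<subseteq> \<B> \<and> (\<forall>B\<in>P. \<forall>C\<in>P. B \<noteq> C \<longrightarrow> B \<inter> C = {})"

definition max_ppc_size :: "nat set set \<Rightarrow> nat \<Rightarrow> bool" where
  "max_ppc_size \<B> \<rho> \<longleftrightarrow>
     (\<exists>P. ppc \<B> P \<and> card P = \<rho>) \<and> \<not> (\<exists>P. ppc \<B> P \<and> card P = \<rho> + 1)"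

definition beta :: "nat \<Rightarrow> nat \<Rightarrow> nat \<Rightarrow> nat" where
  "beta \<rho> v k = (GREATEST n. \<exists>\<B>. packing v k \<B> \<and> max_ppc_size \<B> \<rho> \<and> card \<B> = n)"

end

theory Submission
  imports Defs "HOL-Library.Multiset" "HOL-Library.Disjoint_Sets" "HOL-Number_Theory.Cong"
begin

text \<open>
  Counting pairs bounds the number of blocks by \<open>v (v - 1) / 12\<close>, with equality exactly for Steiner
  systems \<open>S(2, 4, v)\<close>, so one such system with \<open>\<lfloor>v / 4\<rfloor>\<close> disjoint blocks is needed for
  every \<open>v = 12 t + w\<close> with \<open>w \<in> {1, 4}\<close>, except for \<open>v = 13\<close>. Designs with a hole \<open>W\<close> of size \<open>w\<close>
  whose complement is partitioned by blocks can be glued along the hole: given a group divisible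
  design with block sizes 4 and 5 on \<open>t\<close> points, give every point weight 12 (using group divisible
  designs with blocks of size 4 of types \<open>12\<^sup>4\<close> and \<open>12\<^sup>5\<close>) and fill every group together
  with \<open>W\<close>; the partitions of the groups then combine to one of the whole complement of \<open>W\<close>.
  Truncating one group of a transversal design with five groups of size \<open>m\<close> to \<open>u\<close> points, this
  reduces \<open>t = 4 m + u\<close> to \<open>m\<close> and \<open>u\<close>. Such transversal designs exist whenever \<open>m mod 4 \<noteq> 2\<close>
  and \<open>3\<close> does not divide \<open>m\<close>, which leaves finitely many \<open>t\<close>; these come from difference families.
\<close>

section \<open>Decompositions of graphs into cliques\<close>

text \<open>Edges are ordered pairs, so a block of size 4 accounts for 12 of them; this is the 12 in
  the final count.\<close>

definition clique :: "'a set \<Rightarrow> ('a \<times> 'a) set" where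
  "clique V = {(x, y). x \<in> V \<and> y \<in> V \<and> x \<noteq> y}"

text \<open>For complete \<open>E\<close> this is a pairwise balanced design with block sizes in
  \<open>K\<close>, for complete multipartite \<open>E\<close> a group divisible design. The point
  set is not recorded.\<close>

definition decomp :: "nat set \<Rightarrow> ('a \<times> 'a) set \<Rightarrow> 'a set set \<Rightarrow> bool" where
  "decomp K E \<B> \<longleftrightarrow>
     (\<forall>b\<in>\<B>. finite b \<and> card b \<in> K) \<and> (\<Union>b\<in>\<B>. clique b) = E \<and> disjoint_family_on clique \<B>"

text \<open>An incomplete design: no pair inside the hole \<open>W\<close> is covered. A hole of one
  point contains no pairs, and a hole of four points can be filled by one block, so for these two
  sizes a Steiner system results.\<close>

definition holey_design :: "'a set \<Rightarrow> 'a set \<Rightarrow> 'a set set \<Rightarrow> 'a set set \<Rightarrow> bool" where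
  "holey_design X W \<B> P \<longleftrightarrow> W \<subseteq> X \<and> decomp {4} (clique X - clique W) \<B> \<and> P \<subseteq> \<B> \<and> disjoint P \<and> \<Union>P = X - W"

text \<open>Using numbers as points turns existence into a property of \<open>w\<close> and
  \<open>t\<close> alone; \<open>holey_any\<close> and \<open>holeyI\<close> pass to and from other
  point sets.\<close>

definition holey :: "nat \<Rightarrow> nat \<Rightarrow> bool" where
  "holey w t \<longleftrightarrow> (\<exists>(\<B> :: nat set set) P. holey_design {..<12 * t + w} {..<w} \<B> P)"

lemma in_clique [simp]: "(x, y) \<in> clique V \<longleftrightarrow> x \<in> V \<and> y \<in> V \<and> x \<noteq> y"
  by (simp add: clique_def)

lemma decompI:
  assumes "\<And>b. b \<in> \<B> \<Longrightarrow> finite b \<and> card b \<in> K"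
    and "\<And>b x y. b \<in> \<B> \<Longrightarrow> x \<in> b \<Longrightarrow> y \<in> b \<Longrightarrow> x \<noteq> y \<Longrightarrow> (x, y) \<in> E"
    and "\<And>x y. (x, y) \<in> E \<Longrightarrow> x \<noteq> y \<and> (\<exists>b\<in>\<B>. x \<in> b \<and> y \<in> b)"
    and "\<And>b b' x y. b \<in> \<B> \<Longrightarrow> b' \<in> \<B> \<Longrightarrow> x \<in> b \<Longrightarrow> y \<in> b \<Longrightarrow> x \<in> b' \<Longrightarrow> y \<in> b' \<Longrightarrow> x \<noteq> y \<Longrightarrow> b = b'"
  shows "decomp K E \<B>"
proof -
  have "(\<Union>b\<in>\<B>. clique b) = E"
  proof (intro set_eqI iffI)
    fix p assume "p \<in> E" then show "p \<in> (\<Union>b\<in>\<B>. clique b)"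
      using assms(3)[of "fst p" "snd p"] by (cases p) auto
  qed (use assms(2) in auto)
  moreover have "disjoint_family_on clique \<B>"
    unfolding disjoint_family_on_def using assms(4) by fastforce
  ultimately show ?thesis using assms(1) by (simp add: decomp_def)
qed

lemma decompD:
  assumes "decomp K E \<B>"
  shows "\<And>b. b \<in> \<B> \<Longrightarrow> finite b \<and> card b \<in> K"
    and "\<And>b x y. b \<in> \<B> \<Longrightarrow> x \<in> b \<Longrightarrow> y \<in> b \<Longrightarrow> x \<noteq> y \<Longrightarrow> (x, y) \<in> E"
    and "\<And>x y. (x, y) \<in> E \<Longrightarrow> x \<noteq> y"
    and "\<And>x y. (x, y) \<in> E \<Longrightarrow> \<exists>b\<in>\<B>. x \<in> b \<and> y \<in> b"
    and "\<And>b b' x y. b \<in> \<B> \<Longrightarrow> b' \<in> \<B> \<Longrightarrow> x \<in> b \<Longrightarrow> y \<in> b \<Longrightarrow> x \<in> b' \<Longrightarrow> y \<in> b' \<Longrightarrow> x \<noteq> y \<Longrightarrow> b = b'"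
proof -
  show "b = b'" if "b \<in> \<B>" "b' \<in> \<B>" "x \<in> b" "y \<in> b" "x \<in> b'" "y \<in> b'" "x \<noteq> y" for b b' x y
  proof (rule ccontr)
    assume "b \<noteq> b'"
    then have "clique b \<inter> clique b' = {}"
      using assms that by (auto simp: decomp_def disjoint_family_on_def)
    moreover have "(x, y) \<in> clique b \<inter> clique b'" using that by simp
    ultimately show False by blast
  qed
qed (use assms in \<open>auto simp: decomp_def\<close>)

lemma decomp_UN:
  assumes "\<And>i. i \<in> I \<Longrightarrow> decomp K (E i) (\<B> i)" and "disjoint_family_on E I"
  shows "decomp K (\<Union>i\<in>I. E i) (\<Union>i\<in>I. \<B> i)"
proof (rule decompI)
  fix b b' x y
  assume b: "b \<in> (\<Union>i\<in>I. \<B> i)" "b' \<in> (\<Union>i\<in>I. \<B> i)"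
    and xy: "x \<in> b" "y \<in> b" "x \<in> b'" "y \<in> b'" "x \<noteq> y"
  from b obtain i j where ij: "i \<in> I" "j \<in> I" "b \<in> \<B> i" "b' \<in> \<B> j" by auto
  have "(x, y) \<in> E i" "(x, y) \<in> E j"
    using decompD(2)[OF assms(1)[OF ij(1)] ij(3)] decompD(2)[OF assms(1)[OF ij(2)] ij(4)] xy by auto
  then have "i = j"
    using assms(2) ij by (auto simp: disjoint_family_on_def)
  then show "b = b'" using decompD(5)[OF assms(1)[OF ij(1)] ij(3), of b'] ij xy by auto
next
  fix x y assume "(x, y) \<in> (\<Union>i\<in>I. E i)"
  then obtain i where "i \<in> I" "(x, y) \<in> E i" by auto
  then show "x \<noteq> y \<and> (\<exists>b\<in>(\<Union>i\<in>I. \<B> i). x \<in> b \<and> y \<in> b)"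
    using decompD(3)[OF assms(1)] decompD(4)[OF assms(1), of i x y] by (metis UN_I)
next
  fix b assume "b \<in> (\<Union>i\<in>I. \<B> i)"
  then show "finite b \<and> card b \<in> K" using decompD(1)[OF assms(1)] by auto
next
  fix b x y assume "b \<in> (\<Union>i\<in>I. \<B> i)" "x \<in> b" "y \<in> b" "x \<noteq> y"
  then show "(x, y) \<in> (\<Union>i\<in>I. E i)" using decompD(2)[OF assms(1)] by (metis UN_E UN_I)
qed

lemma decomp_Un:
  assumes "decomp K E \<B>" "decomp K E' \<B>'" "E \<inter> E' = {}"
  shows "decomp K (E \<union> E') (\<B> \<union> \<B>')"
proof -
  have "decomp K (\<Union>i\<in>UNIV. if i then E else E') (\<Union>i\<in>UNIV. if i then \<B> else \<B>')"
    by (rule decomp_UN) (use assms in \<open>auto simp: disjoint_family_on_def\<close>)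
  then show ?thesis by (simp add: UNIV_bool Un_commute)
qed

lemma decomp_image:
  assumes d: "decomp K E \<B>" and V: "\<Union>\<B> \<subseteq> V" and f: "inj_on f V"
  shows "decomp K (map_prod f f ` E) ((`) f ` \<B>)"
proof (rule decompI)
  fix b assume "b \<in> (`) f ` \<B>"
  then obtain c where c: "c \<in> \<B>" "b = f ` c" by auto
  then have "inj_on f c" using V f by (meson Sup_upper inj_on_subset subset_trans)
  then show "finite b \<and> card b \<in> K" using decompD(1)[OF d c(1)] c by (simp add: card_image)
next
  fix b x y assume "b \<in> (`) f ` \<B>" "x \<in> b" "y \<in> b" "x \<noteq> y"
  then obtain c x' y' where "c \<in> \<B>" "x' \<in> c" "y' \<in> c" "x = f x'" "y = f y'" "x' \<noteq> y'" by auto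
  then show "(x, y) \<in> map_prod f f ` E" using decompD(2)[OF d] by (metis map_prod_imageI)
next
  fix x y assume "(x, y) \<in> map_prod f f ` E"
  then obtain x' y' where E: "(x', y') \<in> E" "x = f x'" "y = f y'" by auto
  then obtain c where "c \<in> \<B>" "x' \<in> c" "y' \<in> c" using decompD(4)[OF d] by blast
  moreover have "x' \<noteq> y'" using decompD(3)[OF d] E by blast
  ultimately show "x \<noteq> y \<and> (\<exists>b\<in>(`) f ` \<B>. x \<in> b \<and> y \<in> b)"
    using E V f by (auto simp: inj_on_def)
next
  fix b b' x y
  assume "b \<in> (`) f ` \<B>" "b' \<in> (`) f ` \<B>" and xy: "x \<in> b" "y \<in> b" "x \<in> b'" "y \<in> b'" "x \<noteq> y"
  then obtain c c' where c: "c \<in> \<B>" "c' \<in> \<B>" "b = f ` c" "b' = f ` c'" by auto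
  with xy obtain p q p' q' where "p \<in> c" "q \<in> c" "p' \<in> c'" "q' \<in> c'"
    "x = f p" "y = f q" "x = f p'" "y = f q'" by auto
  moreover from this have "p = p'" "q = q'" using V f c by (auto simp: inj_on_def)
  ultimately have "c = c'" using decompD(5)[OF d] c xy(5) by blast
  then show "b = b'" using c by simp
qed

lemma clique_image: "inj_on f V \<Longrightarrow> map_prod f f ` clique V = clique (f ` V)"
  by (auto simp: clique_def inj_on_def image_iff)

lemma clique_mono: "U \<subseteq> V \<Longrightarrow> clique U \<subseteq> clique V"
  by (auto simp: clique_def)

text \<open>A block of size 4 has a second point besides a given one, so each of its points lies on
  an edge of \<open>E\<close>.\<close>

lemma decomp4_subset:
  assumes "decomp {4} E \<B>" "E \<subseteq> V \<times> V" shows "\<Union>\<B> \<subseteq> V"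
proof
  fix x assume "x \<in> \<Union>\<B>"
  then obtain b where b: "b \<in> \<B>" "x \<in> b" by auto
  have "finite b" "\<not> card b \<le> Suc 0" using decompD(1)[OF assms(1)] b by auto
  then obtain y where "y \<in> b" "y \<noteq> x" using b(2) card_le_Suc0_iff_eq by metis
  then show "x \<in> V" using decompD(2)[OF assms(1) b] assms(2) by auto
qed

section \<open>Isomorphic copies of designs with a hole\<close>

lemma holey_design_image:
  assumes n: "holey_design X W \<B> P" and f: "inj_on f X"
  shows "holey_design (f ` X) (f ` W) ((`) f ` \<B>) ((`) f ` P)"
proof -
  have W: "W \<subseteq> X" and d: "decomp {4} (clique X - clique W) \<B>" and P: "P \<subseteq> \<B>" "disjoint P" "\<Union>P = X - W"
    using n by (auto simp: holey_design_def)
  have fW: "inj_on f W" using f W inj_on_subset by blast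
  have "map_prod f f ` (clique X - clique W) = map_prod f f ` clique X - map_prod f f ` clique W"
    by (rule inj_on_image_set_diff[of _ "X \<times> X"]) (use W f in \<open>auto simp: clique_def map_prod_inj_on\<close>)
  also have "\<dots> = clique (f ` X) - clique (f ` W)"
    using clique_image[OF f] clique_image[OF fW] by simp
  finally have im: "map_prod f f ` (clique X - clique W) = clique (f ` X) - clique (f ` W)" .
  have e: "clique X - clique W \<subseteq> X \<times> X" by auto
  have 1: "decomp {4} (clique (f ` X) - clique (f ` W)) ((`) f ` \<B>)"
    using decomp_image[OF d decomp4_subset[OF d e] f] im by simp
  have 2: "disjoint ((`) f ` P)"
    using P f by (intro disjoint_image) (auto intro: inj_on_subset)
  have "\<Union>((`) f ` P) = f ` (X - W)"
    using P by (metis image_Union)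
  also have "\<dots> = f ` X - f ` W"
    by (rule inj_on_image_set_diff[OF f]) (use W in auto)
  finally show ?thesis
    using 1 2 P W by (auto simp: holey_design_def)
qed

lemma bij_extend:
  assumes "finite X" "finite X'" "card X = card X'" "W \<subseteq> X" "W' \<subseteq> X'" "card W = card W'"
  shows "\<exists>f. inj_on f X \<and> f ` X = X' \<and> f ` W = W'"
proof -
  have fin: "finite W" "finite W'" using assms finite_subset by blast+
  obtain g where g: "bij_betw g W W'" using fin assms finite_same_card_bij by metis
  have "card (X - W) = card (X' - W')" using assms fin by (simp add: card_Diff_subset)
  then obtain h where h: "bij_betw h (X - W) (X' - W')"
    using assms finite_same_card_bij[of "X - W" "X' - W'"] by auto
  define f where "f x = (if x \<in> W then g x else h x)" for x
  have 1: "bij_betw f W W'" using g by (rule bij_betw_cong[THEN iffD1, rotated]) (simp add: f_def)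
  have 2: "bij_betw f (X - W) (X' - W')" using h by (rule bij_betw_cong[THEN iffD1, rotated]) (simp add: f_def)
  have "bij_betw f (W \<union> (X - W)) (W' \<union> (X' - W'))" using 1 2 by (rule bij_betw_combine) auto
  then have "bij_betw f X X'" using assms by (simp add: Un_absorb1)
  then show ?thesis using 1 by (auto simp: bij_betw_def)
qed

text \<open>Gluing along a common hole needs designs on prescribed point sets with a prescribed
  hole; the hole and its complement are relabelled separately.\<close>

lemma holey_any:
  assumes "holey w t" "finite X" "card X = 12 * t + w" "W \<subseteq> X" "card W = w"
  shows "\<exists>\<B> P. holey_design X W \<B> P"
proof -
  obtain \<B> P where n: "holey_design {..<12 * t + w} {..<w} (\<B> :: nat set set) P"
    using assms(1) holey_def by blast
  obtain f :: "nat \<Rightarrow> _" where "inj_on f {..<12 * t + w}" "f ` {..<12 * t + w} = X" "f ` {..<w} = W"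
    using bij_extend[of "{..<12 * t + w}" X "{..<w}" W] assms by auto
  then show ?thesis using holey_design_image[OF n] by metis
qed

lemma holeyI:
  assumes n: "holey_design X W \<B> P" and "finite X" "card X = 12 * t + w" "card W = w"
  shows "holey w t"
proof -
  have "W \<subseteq> X" using n by (simp add: holey_design_def)
  then obtain f :: "_ \<Rightarrow> nat" where "inj_on f X" "f ` X = {..<12 * t + w}" "f ` W = {..<w}"
    using bij_extend[of X "{..<12 * t + w}" W "{..<w}"] assms by auto
  then show ?thesis using holey_design_image[OF n, of f] unfolding holey_def by metis
qed

text \<open>The hole is the whole point set, so the empty set of blocks works. This fills the empty
  last group when \<open>u = 0\<close>.\<close>

lemma holey_0: "holey w 0"
  by (auto simp: holey_def holey_design_def decomp_def disjoint_family_on_def intro!: exI[of _ "{}"])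

section \<open>Giving weight to points\<close>

text \<open>Weight \<open>n\<close>: every point becomes \<open>n\<close> copies, joined as the
  original points were. In particular \<open>blow n (clique {..<k})\<close> is the complete
  \<open>k\<close>-partite graph with parts of size \<open>n\<close>, the graph of a group divisible
  design of type n^k.\<close>

definition blow :: "nat \<Rightarrow> ('a \<times> 'a) set \<Rightarrow> (('a \<times> nat) \<times> ('a \<times> nat)) set" where
  "blow n E = {((x, i), (y, j)). (x, y) \<in> E \<and> i < n \<and> j < n}"

lemma in_blow [simp]: "(p, q) \<in> blow n E \<longleftrightarrow> (fst p, fst q) \<in> E \<and> snd p < n \<and> snd q < n"
  by (cases p; cases q) (simp add: blow_def)

text \<open>Mere existence suffices here, because the partition of the complement of the hole is
  built only from blocks of the designs that fill the groups.\<close>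

definition dec4 :: "('a \<times> 'a) set \<Rightarrow> bool" where
  "dec4 E \<longleftrightarrow> (\<exists>\<B>. decomp {4} E \<B>)"

lemma dec4_image:
  assumes "dec4 E" "E \<subseteq> V \<times> V" "inj_on f V"
  shows "dec4 (map_prod f f ` E)"
  using assms decomp_image[OF _ decomp4_subset] unfolding dec4_def by metis

lemma dec4_blow_clique:
  assumes "dec4 (blow n (clique {..<k}))" "finite b" "card b = k"
  shows "dec4 (blow n (clique b))"
proof -
  obtain f where f: "bij_betw f {..<k} b"
    using assms finite_same_card_bij[of "{..<k}" b] by auto
  then have i: "inj_on f {..<k}" and im: "f ` {..<k} = b" by (auto simp: bij_betw_def)
  let ?F = "\<lambda>(x, i). (f x, i :: nat)"
  have "inj_on ?F ({..<k} \<times> {..<n})" using i by (auto simp: inj_on_def)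
  moreover have "blow n (clique {..<k}) \<subseteq> ({..<k} \<times> {..<n}) \<times> ({..<k} \<times> {..<n})" by auto
  ultimately have "dec4 (map_prod ?F ?F ` blow n (clique {..<k}))"
    using assms(1) dec4_image by blast
  moreover have "map_prod ?F ?F ` blow n (clique {..<k}) = blow n (clique b)"
  proof (intro set_eqI iffI)
    fix p assume "p \<in> map_prod ?F ?F ` blow n (clique {..<k})"
    then show "p \<in> blow n (clique b)" using i im by (auto simp: inj_on_def)
  next
    fix p assume "p \<in> blow n (clique b)"
    then obtain x y i j where p: "p = ((f x, i), (f y, j))" "x < k" "y < k" "f x \<noteq> f y" "i < n" "j < n"
      using im by (cases p) force
    then have "((x, i), (y, j)) \<in> blow n (clique {..<k})" by auto
    from imageI[OF this, of "map_prod ?F ?F"]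
    show "p \<in> map_prod ?F ?F ` blow n (clique {..<k})" using p by simp
  qed
  ultimately show ?thesis by simp
qed

text \<open>Wilson's fundamental construction: a block of size \<open>k\<close> is replaced by an
  ingredient of type n^k. Distinct blocks share no edge, hence neither do their ingredients.\<close>

lemma dec4_blow:
  assumes d: "decomp K E \<B>" and K: "\<And>k. k \<in> K \<Longrightarrow> dec4 (blow n (clique {..<k}))"
  shows "dec4 (blow n E)"
proof -
  have "\<forall>b\<in>\<B>. \<exists>\<C>. decomp {4} (blow n (clique b)) \<C>"
    using dec4_blow_clique[OF K] decompD(1)[OF d] unfolding dec4_def by blast
  then obtain \<C> where "\<And>b. b \<in> \<B> \<Longrightarrow> decomp {4} (blow n (clique b)) (\<C> b)" by metis
  moreover have "disjoint_family_on (\<lambda>b. blow n (clique b)) \<B>"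
    unfolding disjoint_family_on_def using decompD(5)[OF d] by fastforce
  ultimately have "decomp {4} (\<Union>b\<in>\<B>. blow n (clique b)) (\<Union>b\<in>\<B>. \<C> b)" by (rule decomp_UN)
  moreover have "(\<Union>b\<in>\<B>. blow n (clique b)) = blow n E"
  proof (intro set_eqI iffI)
    fix p assume "p \<in> (\<Union>b\<in>\<B>. blow n (clique b))"
    then show "p \<in> blow n E" using decompD(2)[OF d] by (cases p) auto
  next
    fix p assume "p \<in> blow n E"
    then show "p \<in> (\<Union>b\<in>\<B>. blow n (clique b))"
      using decompD(3,4)[OF d] by (cases p) fastforce
  qed
  ultimately show ?thesis by (auto simp: dec4_def)
qed

section \<open>Filling the groups of a group divisible design\<close>

text \<open>Pairs above different groups are covered by \<open>d\<close>; every other pair not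
  inside \<open>W\<close> lies in one filled group. The filled groups overlap only in
  \<open>W\<close>, whose pairs none of them covers and which their partitions avoid, so the
  partitions can be united.\<close>

lemma holey_fill:
  fixes T :: "'a set"
  assumes T: "finite T" "disjoint \<G>" "\<Union>\<G> = T"
    and d: "dec4 (blow 12 (clique T - (\<Union>G\<in>\<G>. clique G)))"
    and g: "\<And>G. G \<in> \<G> \<Longrightarrow> holey w (card G)"
  shows "holey w (card T)"
proof -
  \<comment> \<open>The sum type keeps the hole apart from the weighted points.\<close>
  define W where "W = (Inr ` {..<w} :: ('a \<times> nat + nat) set)"
  define Y where "Y G = (Inl ` (G \<times> {..<12}) :: ('a \<times> nat + nat) set)" for G
  define E where "E = clique T - (\<Union>G\<in>\<G>. clique G)"
  have cardY: "card (Y G \<union> W) = 12 * card G + w" "finite (Y G \<union> W)" if "G \<subseteq> T" for G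
  proof -
    have "finite G" using that T finite_subset by blast
    then show "card (Y G \<union> W) = 12 * card G + w" "finite (Y G \<union> W)"
      by (auto simp: Y_def W_def card_Un_disjoint card_image card_cartesian_product disjnt_def)
         (subst card_Un_disjoint; auto simp: card_image card_cartesian_product)
  qed
  have cW: "card W = w" by (simp add: W_def card_image)
  have "\<forall>G\<in>\<G>. \<exists>\<B> P. holey_design (Y G \<union> W) W \<B> P"
  proof
    fix G assume G: "G \<in> \<G>"
    then have "G \<subseteq> T" using T by auto
    from holey_any[OF g[OF G] cardY(2,1)[OF this] _ cW] show "\<exists>\<B> P. holey_design (Y G \<union> W) W \<B> P" by simp
  qed
  then obtain \<B> P where n: "\<And>G. G \<in> \<G> \<Longrightarrow> holey_design (Y G \<union> W) W (\<B> G) (P G)" by metis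
  have "dec4 (map_prod Inl Inl ` blow 12 E :: (('a \<times> nat + nat) \<times> ('a \<times> nat + nat)) set)"
    by (rule dec4_image[where V = UNIV]) (use d in \<open>auto simp: E_def\<close>)
  then obtain \<C> where C: "decomp {4} (map_prod Inl Inl ` blow 12 E :: (('a \<times> nat + nat) \<times> ('a \<times> nat + nat)) set) \<C>"
    by (auto simp: dec4_def)
  define F where "F G = clique (Y G \<union> W) - clique W" for G
  have GT: "\<And>G x. G \<in> \<G> \<Longrightarrow> x \<in> G \<Longrightarrow> x \<in> T" using T by auto
  have Gu: "\<And>G G' x. G \<in> \<G> \<Longrightarrow> G' \<in> \<G> \<Longrightarrow> x \<in> G \<Longrightarrow> x \<in> G' \<Longrightarrow> G = G'"
    using T(2) by (auto simp: disjoint_def)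
  have dF: "decomp {4} (\<Union>G\<in>\<G>. F G) (\<Union>G\<in>\<G>. \<B> G)"
  proof (rule decomp_UN)
    show "decomp {4} (F G) (\<B> G)" if "G \<in> \<G>" for G using n[OF that] by (simp add: holey_design_def F_def)
    show "disjoint_family_on F \<G>"
      unfolding disjoint_family_on_def F_def using Gu by (fastforce simp: Y_def W_def)
  qed
  have dd: "map_prod Inl Inl ` blow 12 E \<inter> (\<Union>G\<in>\<G>. F G) = {}"
    by (auto simp: F_def E_def Y_def W_def)
  have eq: "map_prod Inl Inl ` blow 12 E \<union> (\<Union>G\<in>\<G>. F G) = clique (Y T \<union> W) - clique W" (is "?L = ?R")
  proof (intro set_eqI iffI)
    fix p assume "p \<in> ?L"
    then consider "p \<in> map_prod Inl Inl ` blow 12 E" | G where "G \<in> \<G>" "p \<in> F G" by auto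
    then show "p \<in> ?R"
    proof cases
      case 1 then show ?thesis by (auto simp: E_def Y_def W_def)
    next
      case 2
      have "Y G \<subseteq> Y T" using GT 2 by (auto simp: Y_def)
      then show ?thesis using 2(2) by (cases p) (auto simp: F_def)
    qed
  next
    fix p assume p: "p \<in> ?R"
    obtain a b where ab: "p = (a, b)" by (cases p)
    have m: "a \<in> Y T \<union> W" "b \<in> Y T \<union> W" "a \<noteq> b" "a \<notin> W \<or> b \<notin> W" using p ab by auto
    show "p \<in> ?L"
    \<comment> \<open>A point of \<open>W\<close> shares a filled group with every weighted point,
      so two points without a common filled group both lie outside \<open>W\<close>, above different
      groups.\<close>
    proof (cases "\<exists>G\<in>\<G>. a \<in> Y G \<union> W \<and> b \<in> Y G \<union> W")
      case True then show ?thesis using m ab by (auto simp: F_def)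
    next
      case no: False
      have cov: "\<exists>G\<in>\<G>. z \<in> Y G" if "z \<in> Y T" for z using that T(3) by (auto simp: Y_def)
      have "a \<notin> W" "b \<notin> W" using no cov m by blast+
      then obtain x i y j where xy: "a = Inl (x, i)" "b = Inl (y, j)" "x \<in> T" "y \<in> T" "i < 12" "j < 12"
        using m by (auto simp: Y_def)
      have "(x, y) \<in> E"
      proof -
        have "\<not> (\<exists>G\<in>\<G>. x \<in> G \<and> y \<in> G)" using no xy by (auto simp: Y_def)
        moreover from this have "x \<noteq> y" using xy T(3) by blast
        ultimately show ?thesis using xy by (auto simp: E_def)
      qed
      then have "((x, i), (y, j)) \<in> blow 12 E" using xy by simp
      then have "p \<in> map_prod Inl Inl ` blow 12 E" using xy ab by (metis map_prod_imageI)
      then show ?thesis by blast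
    qed
  qed
  have "decomp {4} (clique (Y T \<union> W) - clique W) (\<C> \<union> (\<Union>G\<in>\<G>. \<B> G))"
    using decomp_Un[OF C dF dd] eq by simp
  moreover have PG: "\<Union>(P G) = Y G" if "G \<in> \<G>" for G
    using n[OF that] by (auto simp: holey_design_def Y_def W_def)
  have "disjoint (\<Union>G\<in>\<G>. P G)"
  proof (rule disjointI)
    fix a b assume ab: "a \<in> (\<Union>G\<in>\<G>. P G)" "b \<in> (\<Union>G\<in>\<G>. P G)" "a \<noteq> b"
    then obtain G H where G: "G \<in> \<G>" "H \<in> \<G>" "a \<in> P G" "b \<in> P H" by auto
    show "a \<inter> b = {}"
    proof (cases "G = H")
      case True then show ?thesis using n G ab(3) by (auto simp: holey_design_def disjoint_def)
    next
      case False
      have "a \<subseteq> Y G" "b \<subseteq> Y H" using PG G by auto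
      moreover have "Y G \<inter> Y H = {}" using Gu G False by (auto simp: Y_def)
      ultimately show ?thesis by blast
    qed
  qed
  moreover have "\<Union>(\<Union>G\<in>\<G>. P G) = (Y T \<union> W) - W"
  proof -
    have "\<Union>(\<Union>G\<in>\<G>. P G) = (\<Union>G\<in>\<G>. \<Union>(P G))" by blast
    also have "\<dots> = (\<Union>G\<in>\<G>. Y G)" using PG by simp
    also have "\<dots> = Y T" using T(3) by (auto simp: Y_def)
    finally show ?thesis by (auto simp: Y_def W_def)
  qed
  moreover have "(\<Union>G\<in>\<G>. P G) \<subseteq> \<C> \<union> (\<Union>G\<in>\<G>. \<B> G)"
    using n unfolding holey_design_def by (meson UN_mono order_refl sup.coboundedI2)
  ultimately have "holey_design (Y T \<union> W) W (\<C> \<union> (\<Union>G\<in>\<G>. \<B> G)) (\<Union>G\<in>\<G>. P G)"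
    by (simp add: holey_design_def)
  then show ?thesis using holeyI cardY[of T] cW by blast
qed

section \<open>Orthogonal arrays\<close>

text \<open>An orthogonal array of strength 2 and index 1 with rows \<open>R\<close> and columns
  \<open>c i\<close>; for \<open>k \<ge> 2\<close> it is the same as a transversal design with
  \<open>k\<close> groups of size \<open>n\<close>. The row type is fixed because an existential
  cannot range over types.\<close>

definition oa :: "nat \<Rightarrow> nat \<Rightarrow> bool" where
  "oa k n \<longleftrightarrow> (\<exists>(R :: (nat \<times> nat) set) c. \<forall>i<k. \<forall>j<k. i \<noteq> j \<longrightarrow>
     bij_betw (\<lambda>r. (c i r, c j r)) R ({..<n} \<times> {..<n}))"

text \<open>Rows and symbols can be renamed freely. Two columns together show that there are
  \<open>n * n\<close> rows, which gives the bijection to the standard row set.\<close>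

lemma oaI:
  assumes k: "k \<ge> 2" and S: "finite S" "card S = n"
    and c: "\<And>i j. i < k \<Longrightarrow> j < k \<Longrightarrow> i \<noteq> j \<Longrightarrow> bij_betw (\<lambda>r. (c i r, c j r)) R (S \<times> S)"
  shows "oa k n"
proof -
  obtain f where f: "bij_betw f S {..<n}"
    using S finite_same_card_bij[of S "{..<n}"] by auto
  obtain g where g: "bij_betw g ({..<n} \<times> {..<n}) R"
  proof -
    have b: "bij_betw (\<lambda>r. (c 0 r, c 1 r)) R (S \<times> S)" using c[of 0 1] k by auto
    then have "finite R" "card R = n * n"
      using S bij_betw_finite bij_betw_same_card by (fastforce simp: card_cartesian_product)+
    then show ?thesis using that finite_same_card_bij[of "{..<n} \<times> {..<n}" R] by auto
  qed
  have "bij_betw (\<lambda>r. (f (c i (g r)), f (c j (g r)))) ({..<n} \<times> {..<n}) ({..<n} \<times> {..<n})"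
    if "i < k" "j < k" "i \<noteq> j" for i j
  proof -
    have "bij_betw (map_prod f f) (S \<times> S) ({..<n} \<times> {..<n})"
      using f by (rule bij_betw_map_prod) fact
    then have "bij_betw (map_prod f f \<circ> ((\<lambda>r. (c i r, c j r)) \<circ> g)) ({..<n} \<times> {..<n}) ({..<n} \<times> {..<n})"
      using bij_betw_trans[OF g c[OF that]] bij_betw_trans by blast
    then show ?thesis by (simp add: comp_def)
  qed
  then show ?thesis unfolding oa_def by (intro exI[of _ "{..<n} \<times> {..<n}"] exI[of _ "\<lambda>i r. f (c i (g r))"]) simp
qed

text \<open>MacNeish's product: rows and symbols are pairs, and each column acts
  componentwise.\<close>

lemma oa_product:
  assumes k: "k \<ge> 2" and "oa k m" "oa k n"
  shows "oa k (m * n)"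
proof -
  obtain R c where c: "\<And>i j. i < k \<Longrightarrow> j < k \<Longrightarrow> i \<noteq> j \<Longrightarrow> bij_betw (\<lambda>r. (c i r, c j r)) (R :: (nat \<times> nat) set) ({..<m} \<times> {..<m})"
    using assms unfolding oa_def by meson
  obtain R' c' where c': "\<And>i j. i < k \<Longrightarrow> j < k \<Longrightarrow> i \<noteq> j \<Longrightarrow> bij_betw (\<lambda>r. (c' i r, c' j r)) (R' :: (nat \<times> nat) set) ({..<n} \<times> {..<n})"
    using assms unfolding oa_def by meson
  show ?thesis
  proof (rule oaI[OF k])
    show "finite ({..<m} \<times> {..<n})" "card ({..<m} \<times> {..<n}) = m * n" by (simp_all add: card_cartesian_product)
    fix i j assume ij: "i < k" "j < k" "i \<noteq> j"
    have "bij_betw (\<lambda>((a, b), (a', b')). ((a, a'), (b, b'))) (({..<m} \<times> {..<m}) \<times> ({..<n} \<times> {..<n})) (({..<m} \<times> {..<n}) \<times> ({..<m} \<times> {..<n}))"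
      by (rule bij_betwI[where g = "\<lambda>((a, a'), (b, b')). ((a, b), (a', b'))"]) auto
    with bij_betw_map_prod[OF c[OF ij] c'[OF ij]]
    have "bij_betw ((\<lambda>((a, b), (a', b')). ((a, a'), (b, b'))) \<circ> map_prod (\<lambda>r. (c i r, c j r)) (\<lambda>r. (c' i r, c' j r)))
      (R \<times> R') (({..<m} \<times> {..<n}) \<times> ({..<m} \<times> {..<n}))" by (rule bij_betw_trans)
    then show "bij_betw (\<lambda>r. (map_prod (c i) (c' i) r, map_prod (c j) (c' j) r)) (R \<times> R') (({..<m} \<times> {..<n}) \<times> {..<m} \<times> {..<n})"
      by (simp add: comp_def map_prod_def split_beta)
  qed
qed

lemma oa_mono: "oa k n \<Longrightarrow> l \<le> k \<Longrightarrow> oa l n"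
  unfolding oa_def by (meson less_le_trans)

text \<open>Column \<open>i\<close> is the linear form \<open>a i * x + b i * y\<close> over the
  integers modulo \<open>m\<close>. Two such forms determine \<open>x\<close> and \<open>y\<close>
  when their determinant is a unit.\<close>

lemma oa_slopes:
  fixes a b :: "nat \<Rightarrow> int" and m :: nat
  assumes k: "k \<ge> 2" and m: "m > 0"
    and co: "\<And>i j. i < k \<Longrightarrow> j < k \<Longrightarrow> i \<noteq> j \<Longrightarrow> coprime (a i * b j - a j * b i) (int m)"
  shows "oa k m"
proof (rule oaI[OF k])
  let ?S = "{0..<int m}"
  let ?c = "\<lambda>i (x, y). (a i * x + b i * y) mod int m"
  show "finite ?S" "card ?S = m" by simp_all
  fix i j assume ij: "i < k" "j < k" "i \<noteq> j"
  define d where "d = a i * b j - a j * b i"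
  have d: "coprime d (int m)" using co[OF ij] by (simp add: d_def)
  let ?f = "\<lambda>r. (?c i r, ?c j r)"
  have into: "?f ` (?S \<times> ?S) \<subseteq> ?S \<times> ?S" using m by auto
  have "inj_on ?f (?S \<times> ?S)"
  proof (rule inj_onI)
    fix p q assume pq: "p \<in> ?S \<times> ?S" "q \<in> ?S \<times> ?S" "?f p = ?f q"
    obtain x y x' y' where e: "p = (x, y)" "q = (x', y')" by (cases p, cases q) auto
    have 1: "[a i * x + b i * y = a i * x' + b i * y'] (mod int m)"
      and 2: "[a j * x + b j * y = a j * x' + b j * y'] (mod int m)"
      using pq e by (auto simp: cong_def)
    have 1: "int m dvd a i * (x - x') + b i * (y - y')"
      using 1 by (simp add: cong_iff_dvd_diff algebra_simps)
    have 2: "int m dvd a j * (x - x') + b j * (y - y')"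
      using 2 by (simp add: cong_iff_dvd_diff algebra_simps)
    \<comment> \<open>Cramer's rule: this combination eliminates \<open>y - y'\<close>, the later
      one \<open>x - x'\<close>.\<close>
    have "int m dvd b j * (a i * (x - x') + b i * (y - y')) - b i * (a j * (x - x') + b j * (y - y'))"
      using 1 2 by (intro dvd_diff dvd_mult)
    also have "\<dots> = d * (x - x')" by (simp add: d_def algebra_simps)
    finally have x: "int m dvd x - x'" using d by (simp add: coprime_dvd_mult_right_iff coprime_commute)
    have "int m dvd a i * (a j * (x - x') + b j * (y - y')) - a j * (a i * (x - x') + b i * (y - y'))"
      using 1 2 by (intro dvd_diff dvd_mult)
    also have "\<dots> = d * (y - y')" by (simp add: d_def algebra_simps)
    finally have y: "int m dvd y - y'" using d by (simp add: coprime_dvd_mult_right_iff coprime_commute)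
    have "x mod int m = x' mod int m" "y mod int m = y' mod int m"
      using x y by (simp_all add: mod_eq_dvd_iff)
    then show "p = q" using pq e by simp
  qed
  then have "?f ` (?S \<times> ?S) = ?S \<times> ?S" using into by (intro card_subset_eq) (auto simp: card_image)
  then show "bij_betw ?f (?S \<times> ?S) (?S \<times> ?S)" using \<open>inj_on ?f _\<close> by (simp add: bij_betw_def)
qed

text \<open>The forms are x, y, x + y, x - y and x + 2 y. Their pairwise determinants are 1, 2 and 3
  up to sign, hence units modulo \<open>m\<close>.\<close>

lemma oa_5_coprime_6:
  assumes "coprime m 6" "m > 0" shows "oa 5 m"
proof (rule oa_slopes)
  let ?a = "\<lambda>i :: nat. [1, 0, 1, 1, 1] ! i :: int"
  let ?b = "\<lambda>i :: nat. [0, 1, 1, -1, 2] ! i :: int"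
  have "coprime (int m) (int 6)" using assms(1) by (simp only: coprime_int_iff)
  then have c: "coprime (int m) 6" by simp
  have "coprime (int m) 2" "coprime (int m) 3"
    using c coprime_mult_right_iff[of "int m" 2 3] by simp_all
  then have c23: "coprime 2 (int m)" "coprime 3 (int m)" by (simp_all add: coprime_commute)
  fix i j :: nat assume ij: "i < 5" "j < 5" "i \<noteq> j"
  have "i \<in> {0, 1, 2, 3, 4}" "j \<in> {0, 1, 2, 3, 4}" using ij by auto
  then show "coprime (?a i * ?b j - ?a j * ?b i) (int m)"
    using ij(3) c23 by (auto simp: numeral_2_eq_2 numeral_3_eq_3 numeral_eq_Suc)
qed (use assms in auto)

text \<open>The forms x, y, x + y and x - y have determinants 1 and 2 up to sign, which are units
  modulo 3.\<close>

lemma oa_4_3: "oa 4 3"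
proof (rule oa_slopes)
  let ?a = "\<lambda>i :: nat. [1, 0, 1, 1] ! i :: int"
  let ?b = "\<lambda>i :: nat. [0, 1, 1, -1] ! i :: int"
  fix i j :: nat assume ij: "i < 4" "j < 4" "i \<noteq> j"
  have "coprime (2 :: int) 3" by code_simp
  then have c: "coprime 2 (int 3)" "coprime (-2) (int 3)" by simp_all
  have "i \<in> {0, 1, 2, 3}" "j \<in> {0, 1, 2, 3}" using ij by auto
  then show "coprime (?a i * ?b j - ?a j * ?b i) (int 3)"
    using ij(3) c by (auto simp: numeral_eq_Suc)
qed auto

section \<open>Arrays verified by evaluation\<close>

text \<open>
  Only the preservation of the multiset of entries is needed of this sorting function; it is much
  faster under symbolic evaluation than the library implementation of \<^const>\<open>sort\<close>.
\<close>

fun merge :: "'a :: linorder list \<Rightarrow> 'a list \<Rightarrow> 'a list" where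
  "merge [] ys = ys"
| "merge xs [] = xs"
| "merge (x # xs) (y # ys) = (if x \<le> y then x # merge xs (y # ys) else y # merge (x # xs) ys)"

fun merge_adj :: "'a :: linorder list list \<Rightarrow> 'a list list" where
  "merge_adj (xs # ys # zss) = merge xs ys # merge_adj zss"
| "merge_adj xss = xss"

lemma length_merge_adj: "length (merge_adj xss) \<le> length xss"
  by (induction xss rule: merge_adj.induct) auto

function merge_all :: "'a :: linorder list list \<Rightarrow> 'a list" where
  "merge_all [] = []"
| "merge_all [xs] = xs"
| "merge_all (xs # ys # zss) = merge_all (merge xs ys # merge_adj zss)"
  by pat_completeness auto
termination
  by (relation "measure length") (auto simp: less_Suc_eq_le length_merge_adj le_SucI)

definition msort :: "'a :: linorder list \<Rightarrow> 'a list" where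
  "msort xs = merge_all (map (\<lambda>x. [x]) xs)"

lemma mset_merge: "mset (merge xs ys) = mset xs + mset ys"
  by (induction xs ys rule: merge.induct) auto

lemma mset_merge_adj: "mset (concat (merge_adj xss)) = mset (concat xss)"
  by (induction xss rule: merge_adj.induct) (auto simp: mset_merge)

lemma mset_merge_all: "mset (merge_all xss) = mset (concat xss)"
  by (induction xss rule: merge_all.induct) (auto simp: mset_merge mset_merge_adj)

lemma mset_msort: "mset (msort xs) = mset xs"
  by (simp add: msort_def mset_merge_all)

text \<open>One evaluation of \<open>msort\<close> yields both facts that every check below relies
  on: which values occur, and that none is repeated.\<close>

lemma msort_eqD:
  assumes "msort xs = ys" shows "set xs = set ys" "distinct xs \<longleftrightarrow> distinct ys"
proof -
  have "mset xs = mset ys" using assms mset_msort by metis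
  then show "set xs = set ys" "distinct xs \<longleftrightarrow> distinct ys"
    using mset_eq_setD mset_eq_imp_distinct_iff by blast+
qed

text \<open>The pair of entries in columns \<open>i\<close> and \<open>j\<close> is coded as one
  number below \<open>n * n\<close>, so that bijectivity becomes equality of two lists. Swapping
  coordinates reduces the test to \<open>j < i\<close>.\<close>

definition oa_check :: "nat \<Rightarrow> int \<Rightarrow> (int \<Rightarrow> int \<Rightarrow> int list) \<Rightarrow> bool" where
  "oa_check k n f \<longleftrightarrow> (\<forall>i\<in>set [0..<k]. \<forall>j\<in>set [0..<i].
     msort [n * (f x y ! i) + f x y ! j. x \<leftarrow> [0..n - 1], y \<leftarrow> [0..n - 1]] = [0..n * n - 1]) \<and>
     (\<forall>x\<in>set [0..n - 1]. \<forall>y\<in>set [0..n - 1]. \<forall>i\<in>set [0..<k]. 0 \<le> f x y ! i \<and> f x y ! i < n)"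

lemma oa_checkI:
  assumes k: "k \<ge> 2" and n: "n > 0" and ch: "oa_check k n f"
  shows "oa k (nat n)"
proof (rule oaI[OF k])
  let ?S = "{0..<n}"
  show "finite ?S" "card ?S = nat n" by auto
  have S: "set [0..n - 1] = ?S" by auto
  have rng: "f x y ! i \<in> ?S" if "x \<in> ?S" "y \<in> ?S" "i < k" for x y i
    using ch that unfolding oa_check_def S by auto
  have *: "bij_betw (\<lambda>(x, y). (f x y ! i, f x y ! j)) (?S \<times> ?S) (?S \<times> ?S)" if ij: "i < k" "j < i" for i j
  proof -
    let ?g = "\<lambda>(x, y). (f x y ! i, f x y ! j)"
    have "msort [n * (f x y ! i) + f x y ! j. x \<leftarrow> [0..n - 1], y \<leftarrow> [0..n - 1]] = [0..n * n - 1]"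
      using ch ij by (auto simp: oa_check_def)
    then have "set [n * (f x y ! i) + f x y ! j. x \<leftarrow> [0..n - 1], y \<leftarrow> [0..n - 1]] = set [0..n * n - 1]"
      by (rule msort_eqD)
    also have "\<dots> = {0..<n * n}" by auto
    finally have *: "set [n * (f x y ! i) + f x y ! j. x \<leftarrow> [0..n - 1], y \<leftarrow> [0..n - 1]] = {0..<n * n}" .
    have "(\<lambda>(x, y). n * (f x y ! i) + f x y ! j) ` (?S \<times> ?S)
        = set [n * (f x y ! i) + f x y ! j. x \<leftarrow> [0..n - 1], y \<leftarrow> [0..n - 1]]"
      by (auto simp del: set_upto simp add: S)
    then have im: "(\<lambda>(x, y). n * (f x y ! i) + f x y ! j) ` (?S \<times> ?S) = {0..<n * n}"
      by (simp only: *)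
    \<comment> \<open>The codes exhaust a set as large as the set of rows, so no two rows have the
      same code.\<close>
    have "card {0..<n * n} = card (?S \<times> ?S)" using n by (simp add: card_cartesian_product nat_mult_distrib)
    then have "inj_on (\<lambda>(x, y). n * (f x y ! i) + f x y ! j) (?S \<times> ?S)"
      using im by (intro eq_card_imp_inj_on) auto
    then have inj: "inj_on ?g (?S \<times> ?S)" by (auto simp: inj_on_def)
    have "?g ` (?S \<times> ?S) \<subseteq> ?S \<times> ?S" using rng ij by auto
    then have "?g ` (?S \<times> ?S) = ?S \<times> ?S" using inj by (intro card_subset_eq) (auto simp: card_image)
    then show ?thesis using inj by (simp add: bij_betw_def)
  qed
  fix i j assume ij: "i < k" "j < k" "i \<noteq> j"
  let ?c = "\<lambda>i (x, y). f x y ! i"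
  show "bij_betw (\<lambda>r. (?c i r, ?c j r)) (?S \<times> ?S) (?S \<times> ?S)"
  proof (cases "j < i")
    case True
    have "(\<lambda>r. (?c i r, ?c j r)) = (\<lambda>(x, y). (f x y ! i, f x y ! j))" by auto
    then show ?thesis using *[OF ij(1) True] by (simp only:)
  next
    case False
    then have "bij_betw (\<lambda>(x, y). (f x y ! j, f x y ! i)) (?S \<times> ?S) (?S \<times> ?S)" using *[of j i] ij by simp
    moreover have "bij_betw prod.swap (?S \<times> ?S) (?S \<times> ?S)" by (rule bij_betwI[where g = prod.swap]) auto
    ultimately have "bij_betw (prod.swap \<circ> (\<lambda>(x, y). (f x y ! j, f x y ! i))) (?S \<times> ?S) (?S \<times> ?S)"
      by (rule bij_betw_trans)
    moreover have "(\<lambda>r. (?c i r, ?c j r)) = prod.swap \<circ> (\<lambda>(x, y). (f x y ! j, f x y ! i))" by auto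
    ultimately show ?thesis by (simp only:)
  qed
qed

text \<open>
  In the next three arrays each table is multiplication by one of four elements of the finite field
  whose elements are coded by their digits, and the columns are \<open>y\<close> and \<open>x + s y\<close> for these \<open>s\<close>.
\<close>

lemma oa_5_4: "oa 5 4"
proof -
  have "oa_check 5 4 (\<lambda>x y. y # map (\<lambda>t. let z = t ! nat y in
    2 * ((x div 2 + z div 2) mod 2) + (x + z) mod 2)
    [[0,0,0,0], [0,1,2,3], [0,2,3,1], [0,3,1,2]])"
    by code_simp
  from oa_checkI[OF _ _ this] show ?thesis by simp
qed

lemma oa_5_8: "oa 5 8"
proof -
  have "oa_check 5 8 (\<lambda>x y. y # map (\<lambda>t. let z = t ! nat y in
    4 * ((x div 4 + z div 4) mod 2) + 2 * ((x div 2 + z div 2) mod 2) + (x + z) mod 2)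
    [[0,0,0,0,0,0,0,0], [0,1,2,3,4,5,6,7], [0,2,4,6,3,1,7,5], [0,3,6,5,7,4,1,2]])"
    by code_simp
  from oa_checkI[OF _ _ this] show ?thesis by simp
qed

lemma oa_5_9: "oa 5 9"
proof -
  have "oa_check 5 9 (\<lambda>x y. y # map (\<lambda>t. let z = t ! nat y in
    3 * ((x div 3 + z div 3) mod 3) + (x + z) mod 3)
    [[0,0,0,0,0,0,0,0,0], [0,1,2,3,4,5,6,7,8], [0,2,1,6,8,7,3,5,4], [0,3,6,2,5,8,1,4,7]])"
    by code_simp
  from oa_checkI[OF _ _ this] show ?thesis by simp
qed

lemma oa_4_12: "oa 4 12"
  using oa_product[OF _ oa_4_3 oa_mono[OF oa_5_4]] by simp

text \<open>Splitting off factors 4 reduces the exponent to 2 or 3, where the fields with 4 and 8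
  elements give arrays.\<close>

lemma oa_5_pow2: "a \<ge> 2 \<Longrightarrow> oa 5 (2 ^ a)"
proof (induction a rule: less_induct)
  case (less a)
  consider "a = 2" | "a = 3" | "a \<ge> 4" using less.prems by linarith
  then show ?case
  proof cases
    case 3
    then obtain b where b: "a = 2 + b" "b \<ge> 2" using that[of "a - 2"] by simp
    then have "oa 5 (2 ^ b)" using less.IH[of b] by simp
    from oa_product[OF _ oa_5_4 this] show ?thesis by (simp add: b power_add)
  qed (use oa_5_4 oa_5_8 in auto)
qed

text \<open>The condition modulo 4 says that 2 does not divide \<open>m\<close> exactly once, so the
  power of 2 in \<open>m\<close> is 1 or at least 4; the odd part is coprime to 6. The product
  construction joins the two.\<close>

lemma oa_5:
  assumes "m > 0" "m mod 4 \<noteq> 2" "m mod 3 \<noteq> 0"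
  shows "oa 5 m"
proof -
  obtain a q where m: "m = 2 ^ a * q" "odd q"
    using assms(1) prime_power_canonical[of "2 :: nat" m] by (metis mult.commute two_is_prime_nat)
  have q3: "\<not> 3 dvd q" using assms(3) m by auto
  have "coprime q 6"
  proof -
    have "coprime 2 q" "coprime 3 q"
      using m q3 prime_imp_coprime[of 2 q] prime_imp_coprime[of 3 q] by simp_all
    then have "coprime q 2" "coprime q 3" by (simp_all only: coprime_commute)
    then have "coprime q (2 * 3)" by (simp only: coprime_mult_right_iff)
    then show ?thesis by simp
  qed
  then have oq: "oa 5 q" using oa_5_coprime_6 m by (simp add: odd_pos)
  have "a \<noteq> 1"
  proof
    assume "a = 1"
    then have "m = 2 * q" using m by simp
    with m(2) have "m mod 4 = 2" by presburger
    then show False using assms by simp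
  qed
  then consider "a = 0" | "a \<ge> 2" by linarith
  then show ?thesis
    using oa_product[OF _ oa_5_pow2 oq] oq m by cases auto
qed

section \<open>From orthogonal arrays to truncated transversal designs\<close>

text \<open>A row becomes the block of its pairs (column, entry), cut down to \<open>U\<close>. Two
  entries in different columns determine the row, so each pair across columns lies in one block. The
  block sizes are bounded through arbitrary functions \<open>h\<close>, so nothing about the actual
  rows has to be known.\<close>

lemma oa_decomp:
  assumes "oa k n" and U: "U \<subseteq> {..<k} \<times> {..<n}"
    and K: "\<And>h. h ` {..<k} \<subseteq> {..<n} \<Longrightarrow> card {i. i < k \<and> (i, h i) \<in> U} \<in> K" and k: "k \<ge> 2"
  shows "\<exists>\<B>. decomp K {(p, q). p \<in> U \<and> q \<in> U \<and> fst p \<noteq> fst q} \<B>"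
proof -
  obtain R c where c: "\<And>i j. i < k \<Longrightarrow> j < k \<Longrightarrow> i \<noteq> j \<Longrightarrow>
      bij_betw (\<lambda>r. (c i r, c j r)) (R :: (nat \<times> nat) set) ({..<n} \<times> {..<n})"
    using assms(1) unfolding oa_def by meson
  have rng: "c i r < n" if "r \<in> R" "i < k" for i r
  proof -
    obtain j where "j < k" "i \<noteq> j" using k by (metis One_nat_def Suc_1 Suc_le_lessD Suc_lessD zero_less_Suc zero_neq_one)
    then show ?thesis using bij_betw_apply[OF c[of i j] that(1)] that by auto
  qed
  define B where "B r = {p \<in> U. snd p = c (fst p) r}" for r
  have Bimg: "B r = (\<lambda>i. (i, c i r)) ` {i. i < k \<and> (i, c i r) \<in> U}" for r
    using U by (auto simp: B_def image_iff)
  have "decomp K {(p, q). p \<in> U \<and> q \<in> U \<and> fst p \<noteq> fst q} (B ` R)"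
  proof (rule decompI)
    fix b assume "b \<in> B ` R"
    then obtain r where r: "r \<in> R" "b = B r" by auto
    have "card b = card {i. i < k \<and> (i, c i r) \<in> U}"
      unfolding r Bimg by (rule card_image) (simp add: inj_on_def)
    then show "finite b \<and> card b \<in> K"
      using K[of "\<lambda>i. c i r"] rng[OF r(1)] r(2) by (auto simp: Bimg)
  next
    fix b p q assume "b \<in> B ` R" "p \<in> b" "q \<in> b" "p \<noteq> q"
    then show "(p, q) \<in> {(p, q). p \<in> U \<and> q \<in> U \<and> fst p \<noteq> fst q}"
      by (auto simp: B_def prod_eq_iff)
  next
    fix p q assume "(p, q) \<in> {(p, q). p \<in> U \<and> q \<in> U \<and> fst p \<noteq> fst q}"
    then have pq: "p \<in> U" "q \<in> U" "fst p \<noteq> fst q" by auto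
    then have "fst p < k" "fst q < k" "snd p < n" "snd q < n" using U by auto
    with c[of "fst p" "fst q"] pq(3) have "(snd p, snd q) \<in> (\<lambda>r. (c (fst p) r, c (fst q) r)) ` R"
      by (simp add: bij_betw_def)
    then obtain r where "r \<in> R" "snd p = c (fst p) r" "snd q = c (fst q) r" by auto
    then show "p \<noteq> q \<and> (\<exists>b\<in>B ` R. p \<in> b \<and> q \<in> b)" using pq by (auto simp: B_def)
  next
    fix b b' p q
    assume b: "b \<in> B ` R" "b' \<in> B ` R" and pq: "p \<in> b" "q \<in> b" "p \<in> b'" "q \<in> b'" "p \<noteq> q"
    then obtain r r' where r: "r \<in> R" "r' \<in> R" "b = B r" "b' = B r'" by auto
    have e: "snd p = c (fst p) r" "snd q = c (fst q) r" "snd p = c (fst p) r'" "snd q = c (fst q) r'"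
      and u: "p \<in> U" "q \<in> U" using pq r by (auto simp: B_def)
    then have "fst p \<noteq> fst q" using pq(5) by (auto simp: prod_eq_iff)
    moreover have "fst p < k" "fst q < k" using u U by auto
    ultimately have "inj_on (\<lambda>r. (c (fst p) r, c (fst q) r)) R" using c by (simp add: bij_betw_def)
    then have "r = r'" by (rule inj_onD) (use e r in auto)
    then show "b = b'" using r by simp
  qed
  then show ?thesis by blast
qed

lemma dec4_blow_oa:
  assumes "oa 4 n" shows "dec4 (blow n (clique {..<4 :: nat}))"
proof -
  have "\<exists>\<B>. decomp {4} {(p, q). p \<in> {..<4 :: nat} \<times> {..<n} \<and> q \<in> {..<4} \<times> {..<n} \<and> fst p \<noteq> fst q} \<B>"
  proof (rule oa_decomp[OF assms order_refl])
    fix h :: "nat \<Rightarrow> nat" assume "h ` {..<4} \<subseteq> {..<n}"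
    then have "{i. i < 4 \<and> (i, h i) \<in> {..<4} \<times> {..<n}} = {..<4}" by auto
    then show "card {i. i < 4 \<and> (i, h i) \<in> {..<4} \<times> {..<n}} \<in> {4}" by simp
  qed simp
  moreover have "{(p, q). p \<in> {..<4 :: nat} \<times> {..<n} \<and> q \<in> {..<4} \<times> {..<n} \<and> fst p \<noteq> fst q} = blow n (clique {..<4})"
    by auto
  ultimately show ?thesis by (simp add: dec4_def)
qed

text \<open>A block keeps its four points in the full groups, and its fifth exactly when that point
  survives in the truncated group; hence the sizes 4 and 5, for which \<open>b4\<close> and
  \<open>b5\<close> are the ingredients.\<close>

lemma holey_truncated:
  assumes oa: "oa 5 m" and u: "u \<le> m" and m: "holey w m" and gu: "holey w u"
    and b4: "dec4 (blow 12 (clique {..<4 :: nat}))" and b5: "dec4 (blow 12 (clique {..<5 :: nat}))"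
  shows "holey w (4 * m + u)"
proof -
  define s where "s i = (if i < 4 then m else u)" for i :: nat
  define T where "T = (SIGMA i : {..<5 :: nat}. {..<s i})"
  define G where "G i = {i} \<times> {..<s i}" for i
  have s: "s i \<le> m" for i using u by (simp add: s_def)
  have "\<exists>\<B>. decomp {4, 5} {(p, q). p \<in> T \<and> q \<in> T \<and> fst p \<noteq> fst q} \<B>"
  proof (rule oa_decomp[OF oa])
    show "T \<subseteq> {..<5} \<times> {..<m}" by (auto simp: T_def intro: less_le_trans[OF _ s])
    fix h :: "nat \<Rightarrow> nat" assume "h ` {..<5} \<subseteq> {..<m}"
    then have hm: "h i < m" if "i < 5" for i using that by auto
    have "i < 5 \<and> (i, h i) \<in> T \<longleftrightarrow> i < 4 \<or> i = 4 \<and> h 4 < u" for i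
      using hm[of i] by (cases "i = 4") (auto simp: T_def s_def)
    then have "{i. i < 5 \<and> (i, h i) \<in> T} = {i. i < 4 \<or> i = 4 \<and> h 4 < u}" by (simp only:)
    also have "\<dots> = (if h 4 < u then {..<5} else {..<4})" by auto
    finally show "card {i. i < 5 \<and> (i, h i) \<in> T} \<in> {4, 5}" by simp
  qed simp
  moreover have "{(p, q). p \<in> T \<and> q \<in> T \<and> fst p \<noteq> fst q} = clique T - (\<Union>g\<in>G ` {..<5}. clique g)"
    by (auto simp: T_def G_def)
  ultimately have d: "dec4 (blow 12 (clique T - (\<Union>g\<in>G ` {..<5}. clique g)))"
    using dec4_blow[of "{4, 5}"] b4 b5 by auto
  have "holey w (card T)"
  proof (rule holey_fill[OF _ _ _ d])
    show "finite T" "\<Union> (G ` {..<5}) = T" by (auto simp: T_def G_def)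
    show "disjoint (G ` {..<5})" by (auto simp: disjoint_def G_def)
    fix g assume "g \<in> G ` {..<5}"
    then show "holey w (card g)" using m gu by (auto simp: G_def s_def card_cartesian_product)
  qed
  moreover have "card T = 4 * m + u"
  proof -
    have "{..<5 :: nat} = insert 4 {..<4}" by auto
    then show ?thesis by (simp add: T_def s_def)
  qed
  ultimately show ?thesis by simp
qed

section \<open>Difference families\<close>

text \<open>When \<open>n\<close> divides \<open>v\<close>, these are the cosets of the subgroup
  generated by \<open>n\<close> in the integers modulo \<open>v\<close>.\<close>

definition coset :: "int \<Rightarrow> int \<Rightarrow> int \<Rightarrow> int set" where
  "coset v n i = {x. 0 \<le> x \<and> x < v \<and> x mod n = i}"

lemma card_coset:
  assumes "0 \<le> i" "i < n" "0 \<le> h"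
  shows "finite (coset (h * n) n i)" "card (coset (h * n) n i) = nat h"
proof -
  have "coset (h * n) n i = (\<lambda>j. i + n * j) ` {0..<h}"
  proof (intro set_eqI iffI)
    fix x assume x: "x \<in> coset (h * n) n i"
    then have "x = i + n * (x div n)" by (auto simp: coset_def)
    moreover have "x div n < h"
    proof (rule ccontr)
      assume "\<not> x div n < h"
      then have "n * h \<le> n * (x div n)" using assms by (intro mult_left_mono) auto
      also have "\<dots> \<le> x" using x by (simp add: coset_def flip: minus_mod_eq_mult_div) (use assms in auto)
      finally show False using x by (simp add: coset_def mult.commute)
    qed
    moreover have "0 \<le> x div n" using x assms by (simp add: coset_def pos_imp_zdiv_nonneg_iff)
    ultimately show "x \<in> (\<lambda>j. i + n * j) ` {0..<h}" by auto
  next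
    fix x assume "x \<in> (\<lambda>j. i + n * j) ` {0..<h}"
    then obtain j where "j \<in> {0..<h}" and j1: "x = i + n * j" by blast
    then have j: "x = i + n * j" "0 \<le> j" "j < h" by simp_all
    have "n * (j + 1) \<le> n * h" using j assms by (intro mult_left_mono) auto
    then have "x < h * n" using j assms by (simp add: algebra_simps)
    then show "x \<in> coset (h * n) n i" using j assms by (simp add: coset_def)
  qed
  moreover have "inj_on (\<lambda>j. i + n * j) {0..<h}" using assms by (auto simp: inj_on_def)
  ultimately show "finite (coset (h * n) n i)" "card (coset (h * n) n i) = nat h"
    by (simp_all add: card_image)
qed

text \<open>A difference family relative to the subgroup generated by \<open>n\<close>: each residue
  outside it arises exactly once as a difference within a base block. For \<open>n = v\<close> it is
  an ordinary difference family.\<close>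

definition diff_family :: "int \<Rightarrow> int \<Rightarrow> int list list \<Rightarrow> bool" where
  "diff_family v n D \<longleftrightarrow> (\<forall>B\<in>set D. length B = 4 \<and> distinct B) \<and>
     msort [(x - y) mod v. B \<leftarrow> D, x \<leftarrow> B, y \<leftarrow> B, x \<noteq> y] = filter (\<lambda>d. d mod n \<noteq> 0) [0..v - 1]"

definition translate :: "int \<Rightarrow> int list \<Rightarrow> int \<Rightarrow> int set" where
  "translate v B s = (\<lambda>x. (x + s) mod v) ` set B"

definition dev :: "int \<Rightarrow> int list list \<Rightarrow> int set set" where
  "dev v D = (\<Union>B\<in>set D. translate v B ` {0..<v})"

definition coset_graph :: "int \<Rightarrow> int \<Rightarrow> (int \<times> int) set" where
  "coset_graph v n = {(x, y). x \<in> {0..<v} \<and> y \<in> {0..<v} \<and> x mod n \<noteq> y mod n}"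

text \<open>The residue \<open>x - y\<close> is the difference of just one ordered pair
  \<open>p\<close>, \<open>q\<close> in just one base block, and the shift that takes
  \<open>p\<close> to \<open>x\<close> and \<open>q\<close> to \<open>y\<close> is then
  forced.\<close>

lemma diff_family_decomp:
  assumes v: "v > 0" "n dvd v" and df: "diff_family v n D"
  shows "decomp {4} (coset_graph v n) (dev v D)"
proof -
  define Zs where "Zs = [(B, x, y). B \<leftarrow> D, x \<leftarrow> B, y \<leftarrow> B, x \<noteq> y]"
  define f where "f = (\<lambda>(B :: int list, x, y). (x - y) mod v)"
  have Zs: "(B, x, y) \<in> set Zs \<longleftrightarrow> B \<in> set D \<and> x \<in> set B \<and> y \<in> set B \<and> x \<noteq> y" for B x y
    by (auto simp: Zs_def)
  have "map f Zs = [(x - y) mod v. B \<leftarrow> D, x \<leftarrow> B, y \<leftarrow> B, x \<noteq> y]"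
    by (simp add: Zs_def f_def map_concat comp_def if_distrib cong: if_cong)
  then have s: "msort (map f Zs) = filter (\<lambda>d. d mod n \<noteq> 0) [0..v - 1]"
    using df by (simp add: diff_family_def)
  have inj: "inj_on f (set Zs)"
    using msort_eqD(2)[OF s] by (simp add: distinct_map)
  have rng: "f ` set Zs = {d. 0 \<le> d \<and> d < v \<and> d mod n \<noteq> 0}"
    using msort_eqD(1)[OF s] by auto
  \<comment> \<open>No difference lies in the subgroup, so a base block meets each coset at most
    once; since \<open>n dvd v\<close>, its translates inherit this.\<close>
  have ne: "(x - y) mod n \<noteq> 0" if "B \<in> set D" "x \<in> set B" "y \<in> set B" "x \<noteq> y" for B x y
  proof -
    have "f (B, x, y) \<in> f ` set Zs" using that Zs by blast
    then have "(x - y) mod v mod n \<noteq> 0" unfolding rng by (simp add: f_def)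
    then show ?thesis using v(2) by (simp add: mod_mod_cancel)
  qed
  have modn: "x mod n = y mod n \<longleftrightarrow> (x - y) mod n = 0" for x y :: int
    by (simp add: mod_eq_dvd_iff dvd_eq_mod_eq_0)
  have modv: "x mod v mod n = x mod n" for x using v(2) by (rule mod_mod_cancel)
  have devE: "\<exists>B s. B \<in> set D \<and> 0 \<le> s \<and> s < v \<and> b = translate v B s" if b: "b \<in> dev v D" for b
  proof -
    obtain B s where "B \<in> set D" "s \<in> {0..<v}" "b = translate v B s"
      using b unfolding dev_def by blast
    then show ?thesis by (intro exI[of _ B] exI[of _ s]) simp
  qed
  have tr: "\<exists>p q. p \<in> set B \<and> q \<in> set B \<and> x = (p + s) mod v \<and> y = (q + s) mod v"
    if "x \<in> translate v B s" "y \<in> translate v B s" for x y B s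
    using that by (auto simp: translate_def)
  show ?thesis
  proof (rule decompI)
    fix b assume "b \<in> dev v D"
    then obtain B s where B: "B \<in> set D" "b = translate v B s" using devE by blast
    have "inj_on (\<lambda>x. (x + s) mod v) (set B)"
    proof (rule inj_onI, rule ccontr)
      fix x y assume xy: "x \<in> set B" "y \<in> set B" "(x + s) mod v = (y + s) mod v" "x \<noteq> y"
      then have "(x + s) mod v mod n = (y + s) mod v mod n" by simp
      then have "(x + s - (y + s)) mod n = 0" unfolding modv modn .
      then show False using ne B(1) xy by simp
    qed
    then have "card b = card (set B)" by (simp add: B(2) translate_def card_image)
    then show "finite b \<and> card b \<in> {4}"
      using df B by (simp add: diff_family_def distinct_card translate_def)
  next
    fix b x y assume b: "b \<in> dev v D" and xy: "x \<in> b" "y \<in> b" "x \<noteq> y"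
    then obtain B s where B: "B \<in> set D" "b = translate v B s" using devE by blast
    with xy obtain p q where p: "p \<in> set B" "q \<in> set B" "x = (p + s) mod v" "y = (q + s) mod v"
      using tr by blast
    then have "p \<noteq> q" using xy by auto
    then have "((p + s) - (q + s)) mod n \<noteq> 0" using ne B(1) p by simp
    then have "x mod n \<noteq> y mod n" unfolding p modv modn .
    then show "(x, y) \<in> coset_graph v n" using p v by (simp add: coset_graph_def)
  next
    fix x y assume "(x, y) \<in> coset_graph v n"
    then have xy: "0 \<le> x" "x < v" "0 \<le> y" "y < v" "x mod n \<noteq> y mod n" by (auto simp: coset_graph_def)
    then have "(x - y) mod n \<noteq> 0" unfolding modn by blast
    then have "(x - y) mod v \<in> f ` set Zs" unfolding rng using v modv by simp
    then obtain B p q where z: "(B, p, q) \<in> set Zs" "(x - y) mod v = (p - q) mod v"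
      by (auto simp: f_def)
    \<comment> \<open>The shift taking \<open>p\<close> to \<open>x\<close>; it takes
      \<open>q\<close> to \<open>y\<close> because the two differences agree.\<close>
    define s where "s = (x - p) mod v"
    have "(p + s) mod v = x mod v" by (simp add: s_def mod_add_right_eq)
    moreover have "(q + s) mod v = y mod v"
    proof -
      have "v dvd (x - y) - (p - q)" using z(2) by (simp add: mod_eq_dvd_iff)
      then have "v dvd (q + (x - p)) - y" by (simp add: algebra_simps)
      then have "(q + (x - p)) mod v = y mod v" by (simp only: mod_eq_dvd_iff)
      then show ?thesis by (simp only: s_def mod_add_right_eq)
    qed
    ultimately have "x \<in> translate v B s" "y \<in> translate v B s"
      using z(1) Zs xy by (auto simp: translate_def image_iff intro: bexI[of _ p] bexI[of _ q])
    moreover have "translate v B s \<in> dev v D"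
    proof -
      have "B \<in> set D" "s \<in> {0..<v}" using z(1) Zs v by (simp_all add: s_def)
      then show ?thesis unfolding dev_def by blast
    qed
    ultimately show "x \<noteq> y \<and> (\<exists>b\<in>dev v D. x \<in> b \<and> y \<in> b)" using xy by blast
  next
    fix b b' x y assume "b \<in> dev v D" "b' \<in> dev v D" and xy: "x \<in> b" "y \<in> b" "x \<in> b'" "y \<in> b'" "x \<noteq> y"
    then obtain B s B' s' where B: "B \<in> set D" "b = translate v B s" "B' \<in> set D" "b' = translate v B' s'"
      and s: "0 \<le> s" "s < v" "0 \<le> s'" "s' < v" using devE by blast
    have "x \<in> translate v B s" "y \<in> translate v B s" "x \<in> translate v B' s'" "y \<in> translate v B' s'"
      using xy by (simp_all only: B)
    then obtain p q p' q' where p: "p \<in> set B" "q \<in> set B" "x = (p + s) mod v" "y = (q + s) mod v"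
      and p': "p' \<in> set B'" "q' \<in> set B'" "x = (p' + s') mod v" "y = (q' + s') mod v"
      using tr[of x B s y] tr[of x B' s' y] by metis
    \<comment> \<open>Both blocks represent the same difference, so injectivity of \<open>f\<close>
      identifies base blocks and points; the shifts then agree as well.\<close>
    have "(x - y) mod v = (p - q) mod v" unfolding p by (simp add: mod_diff_eq)
    moreover have "(x - y) mod v = (p' - q') mod v" unfolding p' by (simp add: mod_diff_eq)
    ultimately have e: "f (B, p, q) = f (B', p', q')" by (simp add: f_def)
    have "p \<noteq> q" "p' \<noteq> q'" using xy p p' by auto
    then have "(B, p, q) = (B', p', q')"
      using inj_onD[OF inj e] Zs B p p' by blast
    then have pB: "p' = p" "B' = B" by auto
    have "(p + s) mod v = (p + s') mod v" using p(3) p'(3) pB by simp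
    then have "v dvd (p + s) - (p + s')" by (simp only: mod_eq_dvd_iff)
    then have "s mod v = s' mod v" by (simp add: mod_eq_dvd_iff)
    then have "s = s'" using s by simp
    then show "b = b'" using B pB by simp
  qed
qed

lemma coset_graph_eq:
  assumes "n > 0"
  shows "coset_graph v n = clique {0..<v} - (\<Union>G\<in>coset v n ` {0..<n}. clique G)"
proof (intro set_eqI iffI)
  fix p assume p: "p \<in> clique {0..<v} - (\<Union>G\<in>coset v n ` {0..<n}. clique G)"
  obtain x y where xy: "p = (x, y)" by (cases p)
  have "x mod n \<in> {0..<n}" using assms by simp
  then show "p \<in> coset_graph v n" using p xy by (auto simp: coset_graph_def coset_def)
qed (auto simp: coset_graph_def coset_def)

section \<open>Cyclic constructions of designs with a hole\<close>

text \<open>The \<open>n\<close> cosets, each of size \<open>h\<close>, are the groups of a cyclic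
  group divisible design of type h^n; it gets weight 12 and its groups are filled.\<close>

lemma holey_cyclic_fill:
  assumes b4: "dec4 (blow 12 (clique {..<4 :: nat}))"
    and df: "diff_family (h * n) n D" and h: "h > 0" "n > 0" and g: "holey w (nat h)"
  shows "holey w (nat (h * n))"
proof -
  let ?v = "h * n"
  have v: "?v > 0" using h by simp
  have "holey w (card {0..<?v})"
  proof (rule holey_fill)
    show "disjoint (coset ?v n ` {0..<n})" by (auto simp: disjoint_def coset_def)
    show "\<Union> (coset ?v n ` {0..<n}) = {0..<?v}" using h by (auto simp: coset_def)
    have "dec4 (blow 12 (coset_graph ?v n))"
      using dec4_blow[OF diff_family_decomp[OF v _ df]] b4 by simp
    then show "dec4 (blow 12 (clique {0..<?v} - (\<Union>G\<in>coset ?v n ` {0..<n}. clique G)))"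
      by (simp only: coset_graph_eq[OF h(2)])
    fix G assume "G \<in> coset ?v n ` {0..<n}"
    then show "holey w (card G)" using g card_coset h by auto
  qed simp
  then show ?thesis by simp
qed

text \<open>The subgroup of order four is the hole, and its other cosets are added as blocks. These
  cosets already are the required partition, so no translates need to be selected.\<close>

lemma holey_4_cyclic:
  assumes df: "diff_family (4 * n) n D" and n: "n > 0" "nat (4 * n) = 12 * t + 4"
  shows "holey 4 t"
proof -
  let ?v = "4 * n"
  let ?C = "coset ?v n"
  define \<B> where "\<B> = dev ?v D \<union> (\<Union>i\<in>{1..<n}. {?C i})"
  have c: "finite (?C i)" "card (?C i) = 4" if "0 \<le> i" "i < n" for i
    using card_coset[OF that, of 4] by simp_all
  have d1: "decomp {4} (\<Union>i\<in>{1..<n}. clique (?C i)) (\<Union>i\<in>{1..<n}. {?C i})"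
  proof (rule decomp_UN)
    show "decomp {4} (clique (?C i)) {?C i}" if "i \<in> {1..<n}" for i
      using c that by (auto simp: decomp_def disjoint_family_on_def)
    show "disjoint_family_on (\<lambda>i. clique (?C i)) {1..<n}"
      by (auto simp: disjoint_family_on_def coset_def)
  qed
  have d2: "decomp {4} (coset_graph ?v n) (dev ?v D)"
    by (rule diff_family_decomp[OF _ _ df]) (use n in auto)
  have "decomp {4} (coset_graph ?v n \<union> (\<Union>i\<in>{1..<n}. clique (?C i))) \<B>"
    unfolding \<B>_def by (rule decomp_Un[OF d2 d1]) (auto simp: coset_graph_def coset_def)
  moreover have "coset_graph ?v n \<union> (\<Union>i\<in>{1..<n}. clique (?C i)) = clique {0..<?v} - clique (?C 0)"
  proof (intro set_eqI iffI)
    fix p assume p: "p \<in> clique {0..<?v} - clique (?C 0)"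
    obtain x y where xy: "p = (x, y)" by (cases p)
    have "x mod n \<in> insert 0 {1..<n}" using n by auto (smt (verit) pos_mod_sign pos_mod_bound)+
    then show "p \<in> coset_graph ?v n \<union> (\<Union>i\<in>{1..<n}. clique (?C i))"
      using p xy by (auto simp: coset_graph_def coset_def)
  qed (auto simp: coset_graph_def coset_def)
  moreover have "\<Union>(?C ` {1..<n}) = {0..<?v} - ?C 0"
  proof (intro set_eqI iffI)
    fix x assume x: "x \<in> {0..<?v} - ?C 0"
    then have "x mod n \<noteq> 0" "0 \<le> x mod n" "x mod n < n" using n by (auto simp: coset_def)
    then have "x mod n \<in> {1..<n}" by auto
    then show "x \<in> \<Union>(?C ` {1..<n})" using x by (auto simp: coset_def)
  qed (auto simp: coset_def)
  moreover have "disjoint (?C ` {1..<n})" by (auto simp: disjoint_def coset_def)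
  ultimately have "holey_design {0..<?v} (?C 0) \<B> (?C ` {1..<n})"
    by (auto simp: holey_design_def \<B>_def) (auto simp: coset_def)
  then show ?thesis by (rule holeyI) (use n c in auto)
qed

lemma disjoint_set_concat: "distinct (concat xs) \<Longrightarrow> disjoint (set ` set xs)"
  by (auto simp: distinct_concat_iff disjoint_def)

text \<open>The shifts \<open>S\<close> select the translates that are to partition the complement
  of the hole 0; their range places these translates in \<open>dev\<close>.\<close>

definition near_resolvable :: "int \<Rightarrow> (int list \<times> int list) list \<Rightarrow> bool" where
  "near_resolvable v D \<longleftrightarrow> diff_family v v (map fst D) \<and>
     (\<forall>(B, S)\<in>set D. \<forall>s\<in>set S. 0 \<le> s \<and> s < v) \<and>
     msort (concat [map (\<lambda>x. (x + s) mod v) B. (B, S) \<leftarrow> D, s \<leftarrow> S]) = [1..v - 1]"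

lemma holey_1_cyclic:
  assumes ch: "near_resolvable v D" and v: "v > 0" "nat v = 12 * t + 1"
  shows "holey 1 t"
proof -
  define Ls where "Ls = [map (\<lambda>x. (x + s) mod v) B. (B, S) \<leftarrow> D, s \<leftarrow> S]"
  have df: "diff_family v v (map fst D)" and sr: "\<forall>(B, S)\<in>set D. \<forall>s\<in>set S. 0 \<le> s \<and> s < v"
    and so: "msort (concat Ls) = [1..v - 1]"
    using ch by (simp_all add: near_resolvable_def Ls_def)
  have "coset_graph v v = clique {0..<v} - clique {0}"
    by (auto simp: coset_graph_def)
  then have "decomp {4} (clique {0..<v} - clique {0}) (dev v (map fst D))"
    using diff_family_decomp[OF v(1) _ df] by simp
  moreover have "set ` set Ls \<subseteq> dev v (map fst D)"
  proof
    fix b assume "b \<in> set ` set Ls"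
    then obtain B S s where B: "(B, S) \<in> set D" "s \<in> set S" "b = translate v B s"
      by (auto simp: Ls_def translate_def)
    moreover have "0 \<le> s" "s < v" using sr B by auto
    ultimately show "b \<in> dev v (map fst D)" by (force simp: dev_def)
  qed
  moreover have "disjoint (set ` set Ls)"
    using msort_eqD(2)[OF so] by (intro disjoint_set_concat) simp
  moreover have "\<Union>(set ` set Ls) = {0..<v} - {0}"
  proof -
    have "\<Union>(set ` set Ls) = set (concat Ls)" by simp
    also have "\<dots> = set [1..v - 1]" using msort_eqD(1)[OF so] .
    finally show ?thesis by auto
  qed
  ultimately have "holey_design {0..<v} {0} (dev v (map fst D)) (set ` set Ls)"
    using v by (simp add: holey_design_def)
  then show ?thesis by (rule holeyI) (use v in auto)
qed

section \<open>Designs listed block by block\<close>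

text \<open>Coding ordered pairs as \<open>n * x + y\<close> makes one list comparison express that
  each pair lies exactly once in a block or a group. Groups may have any size, so a single group can
  serve as a hole.\<close>

definition explicit_gdd :: "int \<Rightarrow> int list list \<Rightarrow> int list list \<Rightarrow> bool" where
  "explicit_gdd n gs bs \<longleftrightarrow> (\<forall>b\<in>set bs. length b = 4 \<and> distinct b \<and> (\<forall>x\<in>set b. 0 \<le> x \<and> x < n)) \<and>
     (\<forall>g\<in>set gs. \<forall>x\<in>set g. 0 \<le> x \<and> x < n) \<and>
     msort [n * x + y. b \<leftarrow> bs @ gs, x \<leftarrow> b, y \<leftarrow> b, x \<noteq> y] =
       [n * x + y. x \<leftarrow> [0..n - 1], y \<leftarrow> [0..n - 1], x \<noteq> y]"

lemma int_pair_inj: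
  fixes n :: int
  assumes "0 \<le> y" "y < n" "0 \<le> y'" "y' < n" "n * x + y = n * x' + y'"
  shows "x = x' \<and> y = y'"
proof -
  have "(n * x + y) mod n = (n * x' + y') mod n" using assms by (simp only:)
  then have "y = y'" using assms(1-4) by simp
  then show ?thesis using assms by auto
qed

text \<open>The reference list of \<open>explicit_gdd\<close> is free of repetitions, and
  \<open>msort_eqD\<close> passes this on to the list of coded pairs.\<close>

lemma distinct_rows:
  fixes n :: int
  shows "distinct [n * x + y. x \<leftarrow> [0..n - 1], y \<leftarrow> [0..n - 1], Q x y]"
proof -
  define Zs where "Zs = filter (\<lambda>(x, y). Q x y) (List.product [0..n - 1] [0..n - 1])"
  have "[n * x + y. x \<leftarrow> [0..n - 1], y \<leftarrow> [0..n - 1], Q x y] = map (\<lambda>(x, y). n * x + y) Zs"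
  proof -
    have *: "concat (map (\<lambda>y. if Q x y then [n * x + y] else []) ys) = map (\<lambda>(x, y). n * x + y) (filter (\<lambda>(x, y). Q x y) (map (Pair x) ys))"
      for x ys by (induction ys) auto
    have "concat (map (\<lambda>x. concat (map (\<lambda>y. if Q x y then [n * x + y] else []) ys)) xs)
        = map (\<lambda>(x, y). n * x + y) (filter (\<lambda>(x, y). Q x y) (List.product xs ys))" for xs ys
      by (induction xs) (simp_all add: *)
    then show ?thesis by (simp add: Zs_def)
  qed
  moreover have "distinct (map (\<lambda>(x, y). n * x + y) Zs)"
    unfolding distinct_map
    by (auto simp: Zs_def distinct_product inj_on_def dest: int_pair_inj)
  ultimately show ?thesis by simp
qed

text \<open>Distinctness of the codes separates blocks from one another and from the groups; the set
  of codes shows that every remaining pair is covered.\<close>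

lemma explicit_decomp:
  assumes ch: "explicit_gdd n gs bs"
  shows "decomp {4} (clique {0..<n} - (\<Union>G\<in>set ` set gs. clique G)) (set ` set bs)"
proof -
  define Zs where "Zs cs = [(b, x, y). b \<leftarrow> cs, x \<leftarrow> b, y \<leftarrow> b, x \<noteq> y]" for cs :: "int list list"
  define f where "f = (\<lambda>(b :: int list, x, y). n * x + y)"
  have Zs: "(B, x, y) \<in> set (Zs cs) \<longleftrightarrow> B \<in> set cs \<and> x \<in> set B \<and> y \<in> set B \<and> x \<noteq> y" for B x y cs
    by (auto simp: Zs_def)
  have "map f (Zs cs) = [n * x + y. b \<leftarrow> cs, x \<leftarrow> b, y \<leftarrow> b, x \<noteq> y]" for cs
    by (simp add: Zs_def f_def map_concat comp_def if_distrib cong: if_cong)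
  from this[of "bs @ gs"]
  have s: "msort (map f (Zs (bs @ gs))) = [n * x + y. x \<leftarrow> [0..n - 1], y \<leftarrow> [0..n - 1], x \<noteq> y]"
    using ch by (simp only: explicit_gdd_def)
  have app: "Zs (bs @ gs) = Zs bs @ Zs gs" by (simp add: Zs_def)
  have "distinct (map f (Zs bs @ Zs gs))"
    using msort_eqD(2)[OF s] distinct_rows[where n = n and Q = "(\<noteq>)"] app by simp
  then have inj: "inj_on f (set (Zs bs))" and dj: "f ` set (Zs bs) \<inter> f ` set (Zs gs) = {}"
    by (simp_all add: distinct_map)
  have "set [n * x + y. x \<leftarrow> [0..n - 1], y \<leftarrow> [0..n - 1], x \<noteq> y] = {n * x + y | x y. x \<in> {0..<n} \<and> y \<in> {0..<n} \<and> x \<noteq> y}"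
    by (auto simp: set_concat split: if_splits) blast
  then have rng: "f ` set (Zs bs) \<union> f ` set (Zs gs) = {n * x + y | x y. x \<in> {0..<n} \<and> y \<in> {0..<n} \<and> x \<noteq> y}"
    using msort_eqD(1)[OF s] app by (simp add: image_Un)
  have b: "length b = 4 \<and> distinct b \<and> set b \<subseteq> {0..<n}" if "b \<in> set bs" for b
    using ch that by (auto simp: explicit_gdd_def)
  have g: "set b \<subseteq> {0..<n}" if "b \<in> set gs" for b
    using ch that by (auto simp: explicit_gdd_def)
  show ?thesis
  proof (rule decompI)
    fix c assume "c \<in> set ` set bs"
    then show "finite c \<and> card c \<in> {4}" using b by (auto simp: distinct_card)
  next
    fix c x y assume "c \<in> set ` set bs" and xy: "x \<in> c" "y \<in> c" "x \<noteq> y"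
    then obtain B where B: "B \<in> set bs" "c = set B" by auto
    have m: "x \<in> {0..<n}" "y \<in> {0..<n}" using b[OF B(1)] B xy by auto
    have "(B, x, y) \<in> set (Zs bs)" using B xy Zs by blast
    then have "f (B, x, y) \<notin> f ` set (Zs gs)" using dj by blast
    then have "\<not> (\<exists>G\<in>set gs. x \<in> set G \<and> y \<in> set G)"
      using Zs xy(3) by (force simp: f_def image_iff)
    then show "(x, y) \<in> clique {0..<n} - (\<Union>G\<in>set ` set gs. clique G)"
      using m xy by auto
  next
    fix x y assume xy: "(x, y) \<in> clique {0..<n} - (\<Union>G\<in>set ` set gs. clique G)"
    then have m: "x \<in> {0..<n}" "y \<in> {0..<n}" "x \<noteq> y" by auto
    then have "n * x + y \<in> f ` set (Zs bs) \<union> f ` set (Zs gs)" unfolding rng by blast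
    then obtain B x' y' where z: "(B, x', y') \<in> set (Zs bs) \<or> (B, x', y') \<in> set (Zs gs)" "n * x + y = n * x' + y'"
      by (auto simp: f_def)
    then have "x' \<in> {0..<n}" "y' \<in> {0..<n}" using b[of B] g[of B] Zs by blast+
    then have "x = x' \<and> y = y'" using z(2) m by (intro int_pair_inj[of _ n]) auto
    moreover from this have "(B, x', y') \<notin> set (Zs gs)" using xy Zs by auto
    ultimately show "x \<noteq> y \<and> (\<exists>c\<in>set ` set bs. x \<in> c \<and> y \<in> c)" using z(1) Zs by auto
  next
    fix c c' x y assume "c \<in> set ` set bs" "c' \<in> set ` set bs"
      and xy: "x \<in> c" "y \<in> c" "x \<in> c'" "y \<in> c'" "x \<noteq> y"
    then obtain B B' where B: "B \<in> set bs" "c = set B" "B' \<in> set bs" "c' = set B'" by auto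
    have "f (B, x, y) = f (B', x, y)" by (simp add: f_def)
    then have "(B, x, y) = (B', x, y)" by (rule inj_onD[OF inj]) (use Zs B xy in auto)
    then show "c = c'" using B by simp
  qed
qed

lemma holey_explicit:
  assumes ch: "explicit_gdd n [ws] bs" and ps: "set ps \<subseteq> set bs"
    and so: "msort (ws @ concat ps) = [0..n - 1]"
    and n: "n > 0" "nat n = 12 * t + w" "length ws = w"
  shows "holey w t"
proof -
  have dis: "distinct (ws @ concat ps)" using msort_eqD(2)[OF so] by simp
  have "set (ws @ concat ps) = set [0..n - 1]" using so by (rule msort_eqD)
  then have un: "set ws \<union> \<Union>(set ` set ps) = {0..<n}" by auto
  have "decomp {4} (clique {0..<n} - clique (set ws)) (set ` set bs)"
    using explicit_decomp[OF ch] by simp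
  moreover have "disjoint (set ` set ps)" using dis by (intro disjoint_set_concat) simp
  moreover have "\<Union>(set ` set ps) = {0..<n} - set ws"
    using dis un by auto
  ultimately have "holey_design {0..<n} (set ws) (set ` set bs) (set ` set ps)"
    using ps un by (auto simp: holey_design_def)
  then show ?thesis by (rule holeyI) (use n dis in \<open>auto simp: distinct_card\<close>)
qed

lemma holey_explicit_fill:
  assumes b4: "dec4 (blow 12 (clique {..<4 :: nat}))"
    and ch: "explicit_gdd n gs bs" and so: "msort (concat gs) = [0..n - 1]"
    and g: "\<And>g. g \<in> set gs \<Longrightarrow> holey w (length g)" and n: "n > 0"
  shows "holey w (nat n)"
proof -
  have dis: "distinct (concat gs)" using msort_eqD(2)[OF so] by simp
  have "set (concat gs) = set [0..n - 1]" using so by (rule msort_eqD)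
  then have un: "\<Union>(set ` set gs) = {0..<n}" by auto
  have "holey w (card {0..<n})"
  proof (rule holey_fill)
    show "disjoint (set ` set gs)" using dis by (rule disjoint_set_concat)
    show "\<Union>(set ` set gs) = {0..<n}" by (rule un)
    show "dec4 (blow 12 (clique {0..<n} - (\<Union>G\<in>set ` set gs. clique G)))"
      using dec4_blow[OF explicit_decomp[OF ch]] b4 by simp
    fix G assume "G \<in> set ` set gs"
    then show "holey w (card G)" using g dis by (auto simp: distinct_concat_iff distinct_card)
  qed simp
  then show ?thesis by simp
qed

section \<open>Base cases\<close>

text \<open>
  Base blocks over the integers modulo \<open>12 t + 1\<close>, found by computer search; each one is listed with
  the shifts whose translates, taken together, partition the nonzero residues.
\<close>

lemma holey_1_3: "holey 1 3"
proof -
  have "near_resolvable 37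
    [([0,1,3,24], [4,8,14]), ([0,4,26,32], [23,30,31]), ([0,7,17,25], [22,33,36])]"
    by code_simp
  from holey_1_cyclic[OF this] show ?thesis by simp
qed

lemma holey_1_4: "holey 1 4"
proof -
  have "near_resolvable 49
    [([0,1,5,21], [31,42,45]), ([0,3,30,42], [27,35,48]), ([0,6,14,32], [5,7,12]), ([0,2,11,36],
    [4,22,23])]"
    by code_simp
  from holey_1_cyclic[OF this] show ?thesis by simp
qed

lemma holey_1_5: "holey 1 5"
proof -
  have "near_resolvable 61
    [([0,1,7,12], [7,16,46]), ([0,4,31,44], [18,55,60]), ([0,9,32,46], [35,39,42]),
    ([0,2,10,28], []), ([0,3,19,39], [2,26,31,33,37,54])]"
    by code_simp
  from holey_1_cyclic[OF this] show ?thesis by simp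
qed

lemma holey_1_6: "holey 1 6"
proof -
  have "near_resolvable 73
    [([0,1,8,64], []), ([0,2,16,55], []), ([0,4,32,37], [34,35,50,53,59,61]), ([0,3,24,46],
    [5,28,40]), ([0,6,19,48], []), ([0,11,26,61], [15,16,19,22,36,44,49,58,68])]"
    by code_simp
  from holey_1_cyclic[OF this] show ?thesis by simp
qed

lemma holey_1_7: "holey 1 7"
proof -
  have "near_resolvable 85
    [([0,1,10,68], [32]), ([0,3,14,63], [49,61,66]), ([0,16,35,56], [2,30]), ([0,2,7,30],
    [21,29,71,81]), ([0,4,24,37], [10,53,70,72]), ([0,8,39,51], [4,17,40,54,84]), ([0,6,32,47],
    [13,35])]"
    by code_simp
  from holey_1_cyclic[OF this] show ?thesis by simp
qed

lemma holey_1_8: "holey 1 8"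
proof -
  have "near_resolvable 97
    [([0,1,7,38], [9,30,32]), ([0,10,49,71], [2,54,74]), ([0,16,34,62], [18,59,88]),
    ([0,3,43,56], [1,20,46]), ([0,4,21,86], [56,61,90]), ([0,8,20,50], [21,35,58]),
    ([0,2,25,70], [13,17,67]), ([0,5,14,78], [22,81,91])]"
    by code_simp
  from holey_1_cyclic[OF this] show ?thesis by simp
qed

lemma holey_1_9: "holey 1 9"
proof -
  have "near_resolvable 109
    [([0,1,45,63], [16,27,66]), ([0,2,92,104], [8,31,85]), ([0,3,26,80], [48,81,89]),
    ([0,4,42,79], [41,59,106]), ([0,6,58,94], [24,37,93]), ([0,8,28,76], [69,86,88]),
    ([0,9,22,78], [25,35,49]), ([0,10,24,84], [40,46,98]), ([0,11,50,93], [12,54,91])]"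
    by code_simp
  from holey_1_cyclic[OF this] show ?thesis by simp
qed

lemma holey_1_10: "holey 1 10"
proof -
  have "near_resolvable 121
    [([0,1,43,74], [13,113]), ([0,3,8,101], [39,97]), ([0,9,24,61], [49,117]), ([0,10,59,86],
    [50,88]), ([0,14,40,105], [38,45]), ([0,2,13,34], [10,62,81,93]), ([0,4,22,68],
    [70,86,107,120]), ([0,6,39,102], [1,30,37,65]), ([0,7,36,77], [25,48,112,116]),
    ([0,12,66,83], [16,79,89,118])]"
    by code_simp
  from holey_1_cyclic[OF this] show ?thesis by simp
qed

lemma holey_1_11: "holey 1 11"
proof -
  have "near_resolvable 133
    [([0,1,23,97], [8,20,96,101]), ([0,2,12,45], [14,25,33,106]), ([0,3,11,120],
    [47,87,88,125]), ([0,9,27,107], [121]), ([0,14,34,65], [100]), ([0,21,50,108], [36]),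
    ([0,4,42,81], [62,103]), ([0,7,48,76], [6,46]), ([0,19,49,89], [61,113]), ([0,5,60,66],
    [19,23,63,71,111,115]), ([0,15,32,86], [7,40,41,49,52,77])]"
    by code_simp
  from holey_1_cyclic[OF this] show ?thesis by simp
qed

lemma holey_1_12: "holey 1 12"
proof -
  have "near_resolvable 145
    [([0,5,15,110], [23,40,52,54,113,141,142]), ([0,11,69,85], [3,7,30,32,35,75,80,110,123]),
    ([0,2,29,32], [42,58,68,79,93,103,129,137,138]), ([0,20,65,90], [29,65,116]), ([0,4,23,51],
    [33,73]), ([0,18,54,106], [8,48]), ([0,12,43,104], [39]), ([0,17,63,89], [109]),
    ([0,1,9,22], []), ([0,7,66,103], []), ([0,6,44,68], [83]), ([0,14,78,111], [98])]"
    by code_simp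
  from holey_1_cyclic[OF this] show ?thesis by simp
qed

lemma holey_1_13: "holey 1 13"
proof -
  have "near_resolvable 157
    [([0,1,3,72], [51,90,114]), ([0,4,30,149], [11,106,107]), ([0,5,109,125], [75,79,145]),
    ([0,6,13,95], [61,119,134]), ([0,9,29,64], [19,126,142]), ([0,10,83,108], [13,66,143]),
    ([0,11,61,112], [42,116,130]), ([0,14,42,66], [4,26,86]), ([0,15,46,138], [58,63,148]),
    ([0,17,80,116], [8,101,122]), ([0,18,57,135], [32,38,87]), ([0,21,54,81], [1,112,138]),
    ([0,23,70,113], [7,108,146])]"
    by code_simp
  from holey_1_cyclic[OF this] show ?thesis by simp
qed

lemma holey_1_17: "holey 1 17"
proof -
  have "near_resolvable 205
    [([0,5,25,60], [4,52,86,92,93,120,133,165]), ([0,9,65,91], [25,65,95,122,163]),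
    ([0,15,45,115], [17,35,44,58,60,70,126,200]), ([0,13,41,108], [13,87,127,136,142]),
    ([0,10,50,130], [5,18,21,46,51,144,157,169,174,182,198]), ([0,3,24,151], [78,188]),
    ([0,37,98,136], [11,106]), ([0,14,32,63], [164,189]), ([0,22,73,96], [41,66]),
    ([0,1,44,102], []), ([0,2,19,81], []), ([0,6,33,72], []), ([0,8,121,137], []),
    ([0,7,53,141], [76]), ([0,11,157,169], [42]), ([0,4,87,116], [197,202]), ([0,34,86,128],
    [33,38])]"
    by code_simp
  from holey_1_cyclic[OF this] show ?thesis by simp
qed

lemma holey_1_29: "holey 1 29"
proof -
  have "near_resolvable 349
    [([0,1,3,21], [62,125,193]), ([0,4,28,234], [141,199,283]), ([0,5,35,118], [89,92,336]),
    ([0,6,55,255], [58,76,238]), ([0,7,185,286], [12,250,296]), ([0,8,306,340], [201,310,334]),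
    ([0,10,76,208], [164,213,243]), ([0,11,67,201], [18,315,348]), ([0,12,71,139],
    [256,285,317]), ([0,13,194,232], [101,122,215]), ([0,14,242,265], [16,162,217]),
    ([0,15,176,261], [269,309,320]), ([0,16,69,211], [31,190,225]), ([0,19,129,235],
    [120,170,271]), ([0,22,58,299], [153,323,328]), ([0,25,86,177], [68,166,332]),
    ([0,26,193,250], [54,251,279]), ([0,27,158,295], [44,88,346]), ([0,29,126,203],
    [45,134,237]), ([0,31,93,302], [36,50,177]), ([0,32,74,111], [38,77,150]), ([0,33,153,213],
    [73,255,314]), ([0,39,205,301], [159,165,282]), ([0,40,226,267], [9,13,222]),
    ([0,44,204,284], [186,330,340]), ([0,45,147,259], [263,306,344]), ([0,46,150,225],
    [11,172,307]), ([0,52,157,285], [27,212,220]), ([0,73,162,257], [17,43,229])]"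
    by code_simp
  from holey_1_cyclic[OF this] show ?thesis by simp
qed

text \<open>
  Base blocks over the integers modulo \<open>12 t + 4\<close> relative to the subgroup of order four.
\<close>

lemma holey_4_3: "holey 4 3"
proof -
  have "diff_family (4 * 10) 10
    [[0,1,4,13], [0,2,7,24], [0,6,21,32]]"
    by code_simp
  from holey_4_cyclic[OF this] show ?thesis by simp
qed

lemma holey_4_4: "holey 4 4"
proof -
  have "diff_family (4 * 13) 13
    [[0,4,12,36], [0,1,6,31], [0,2,9,19], [0,3,14,37]]"
    by code_simp
  from holey_4_cyclic[OF this] show ?thesis by simp
qed

lemma holey_4_5: "holey 4 5"
proof -
  have "diff_family (4 * 16) 16
    [[0,2,5,14], [0,1,18,42], [0,7,20,35], [0,8,27,38], [0,4,10,43]]"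
    by code_simp
  from holey_4_cyclic[OF this] show ?thesis by simp
qed

lemma holey_4_6: "holey 4 6"
proof -
  have "diff_family (4 * 19) 19
    [[0,4,11,48], [0,6,16,40], [0,3,8,20], [0,1,22,47], [0,2,45,63], [0,9,35,62]]"
    by code_simp
  from holey_4_cyclic[OF this] show ?thesis by simp
qed

lemma holey_4_7: "holey 4 7"
proof -
  have "diff_family (4 * 22) 22
    [[0,2,13,37], [0,8,39,54], [0,1,19,60], [0,5,21,30], [0,6,20,32], [0,3,7,43], [0,10,27,65]]"
    by code_simp
  from holey_4_cyclic[OF this] show ?thesis by simp
qed

lemma holey_4_8: "holey 4 8"
proof -
  have "diff_family (4 * 25) 25
    [[0,1,20,53], [0,6,14,90], [0,3,21,61], [0,9,31,65], [0,7,36,62], [0,4,15,27], [0,2,30,43],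
    [0,5,37,54]]"
    by code_simp
  from holey_4_cyclic[OF this] show ?thesis by simp
qed

lemma holey_4_9: "holey 4 9"
proof -
  have "diff_family (4 * 28) 28
    [[0,2,42,53], [0,1,16,50], [0,3,24,89], [0,7,19,92], [0,8,17,83], [0,22,52,77], [0,4,10,68],
    [0,13,31,45], [0,5,41,74]]"
    by code_simp
  from holey_4_cyclic[OF this] show ?thesis by simp
qed

lemma holey_4_10: "holey 4 10"
proof -
  have "diff_family (4 * 31) 31
    [[0,4,13,85], [0,12,71,91], [0,17,77,100], [0,1,16,90], [0,2,46,51], [0,3,99,117],
    [0,14,36,68], [0,6,48,69], [0,8,38,105], [0,11,37,95]]"
    by code_simp
  from holey_4_cyclic[OF this] show ?thesis by simp
qed

lemma holey_4_11: "holey 4 11"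
proof -
  have "diff_family (4 * 34) 34
    [[0,2,12,120], [0,6,19,42], [0,3,17,44], [0,4,43,58], [0,1,8,81], [0,22,47,107],
    [0,5,26,88], [0,24,61,91], [0,31,64,96], [0,11,46,98], [0,9,59,79]]"
    by code_simp
  from holey_4_cyclic[OF this] show ?thesis by simp
qed

lemma holey_4_12: "holey 4 12"
proof -
  have "diff_family (4 * 37) 37
    [[0,1,12,28], [0,3,67,115], [0,4,44,53], [0,2,7,26], [0,6,76,133], [0,8,58,105],
    [0,10,71,126], [0,13,54,92], [0,14,34,123], [0,17,52,82], [0,18,63,86], [0,29,60,102]]"
    by code_simp
  from holey_4_cyclic[OF this] show ?thesis by simp
qed

lemma holey_4_13: "holey 4 13"
proof -
  have "diff_family (4 * 40) 40
    [[0,17,47,128], [0,9,50,73], [0,13,29,90], [0,10,21,69], [0,8,28,100], [0,7,22,125],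
    [0,1,25,56], [0,27,65,102], [0,5,44,89], [0,2,6,148], [0,26,62,108], [0,3,54,97],
    [0,19,53,86]]"
    by code_simp
  from holey_4_cyclic[OF this] show ?thesis by simp
qed

section \<open>Ingredients of types 12^4 and 12^5, and small designs outside the cyclic
  series\<close>

lemma dec4_blow_12_4: "dec4 (blow 12 (clique {..<4 :: nat}))"
  by (rule dec4_blow_oa[OF oa_4_12])

text \<open>A cyclic group divisible design of type 3^5 on 15 points gets weight 4, which yields
  type 12^5.\<close>

lemma dec4_blow_12_5: "dec4 (blow 12 (clique {..<5 :: nat}))"
proof -
  have "diff_family 15 5 [[0, 1, 3, 7]]" by code_simp
  then have d: "decomp {4} (coset_graph 15 5) (dev 15 [[0, 1, 3, 7]])"
    by (rule diff_family_decomp[rotated 2]) auto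
  have "dec4 (blow 4 (clique {..<4 :: nat}))"
    by (rule dec4_blow_oa[OF oa_mono[OF oa_5_4]]) simp
  then have b: "dec4 (blow 4 (coset_graph 15 5))" using dec4_blow[OF d] by simp
  \<comment> \<open>The coset \<open>x mod 5\<close> becomes the group; the place
    \<open>x div 5\<close> in the coset and the copy \<open>i\<close> combine to one of 12
    positions.\<close>
  define f where "f = (\<lambda>(x :: int, i :: nat). (nat (x mod 5), 4 * nat (x div 5) + i))"
  have E: "blow 4 (coset_graph 15 5) \<subseteq> ({0..<15} \<times> {..<4}) \<times> ({0..<15} \<times> {..<4})"
    by (auto simp: coset_graph_def)
  have "inj_on f ({0..<15} \<times> {..<4})"
  proof (rule inj_onI)
    fix p q assume pq: "p \<in> {0..<15} \<times> {..<4 :: nat}" "q \<in> {0..<15} \<times> {..<4}" "f p = f q"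
    obtain x i y j where xy: "p = (x, i)" "q = (y, j)" by (cases p, cases q) auto
    have r: "0 \<le> x" "x < 15" "0 \<le> y" "y < 15" "i < 4" "j < 4" using pq xy by auto
    have "x mod 5 = y mod 5" using pq(3) xy by (simp add: f_def eq_nat_nat_iff)
    moreover have e: "4 * nat (x div 5) + i = 4 * nat (y div 5) + j" using pq(3) xy by (simp add: f_def)
    have "nat (x div 5) = nat (y div 5)" "i = j"
      using arg_cong[OF e, of "\<lambda>k. k div 4"] arg_cong[OF e, of "\<lambda>k. k mod 4"] r by simp_all
    then have "x div 5 = y div 5" "i = j" using r by (simp_all add: eq_nat_nat_iff pos_imp_zdiv_nonneg_iff)
    ultimately show "p = q" using xy by (metis mult_div_mod_eq)
  qed
  from dec4_image[OF b E this] have "dec4 (map_prod f f ` blow 4 (coset_graph 15 5))" .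
  moreover have "map_prod f f ` blow 4 (coset_graph 15 5) = blow 12 (clique {..<5})"
  proof (intro set_eqI iffI)
    fix p assume "p \<in> map_prod f f ` blow 4 (coset_graph 15 5)"
    then obtain x i y j where p: "p = (f (x, i), f (y, j))" and r: "0 \<le> x" "x < 15" "0 \<le> y" "y < 15"
      "x mod 5 \<noteq> y mod 5" "i < 4" "j < 4"
      by (auto simp: coset_graph_def)
    have "nat (x div 5) \<le> 2" "nat (y div 5) \<le> 2" using r by linarith+
    then have "4 * nat (x div 5) + i < 12" "4 * nat (y div 5) + j < 12" using r by linarith+
    moreover have "nat (x mod 5) \<noteq> nat (y mod 5)" using r by (simp add: eq_nat_nat_iff)
    moreover have "nat (x mod 5) < 5" "nat (y mod 5) < 5" by linarith+
    ultimately show "p \<in> blow 12 (clique {..<5})"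
      unfolding p f_def by (simp only: in_blow in_clique prod.case fst_conv snd_conv lessThan_iff simp_thms)
  next
    fix p :: "(nat \<times> nat) \<times> (nat \<times> nat)" assume "p \<in> blow 12 (clique {..<5})"
    then obtain a c b e where p: "p = ((a, c), (b, e))" "a < 5" "b < 5" "a \<noteq> b" "c < 12" "e < 12"
      by (cases p) auto
    \<comment> \<open>The inverse of \<open>f\<close>: \<open>int a + 5 * int (c div 4)\<close> has
      remainder \<open>a\<close> and quotient \<open>c div 4\<close> modulo 5.\<close>
    define g where "g a c = (int a + 5 * int (c div 4), c mod 4)" for a c :: nat
    have fg: "f (g a c) = (a, c)" if "a < 5" for a c
    proof -
      have "(int a + 5 * int (c div 4)) mod 5 = int a" "(int a + 5 * int (c div 4)) div 5 = int (c div 4)"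
        using that by simp_all
      then show ?thesis by (simp only: f_def g_def prod.case nat_int) simp
    qed
    have "(g a c, g b e) \<in> blow 4 (coset_graph 15 5)"
    proof -
      have "c div 4 < 3" "e div 4 < 3" using p by (simp_all add: div_less_iff_less_mult)
      then have "int a + 5 * int (c div 4) < 15" "int b + 5 * int (e div 4) < 15"
        using p by linarith+
      then show ?thesis using p by (auto simp: g_def coset_graph_def)
    qed
    from imageI[OF this, of "map_prod f f"]
    show "p \<in> map_prod f f ` blow 4 (coset_graph 15 5)" using fg p by simp
  qed
  ultimately show ?thesis by simp
qed

text \<open>A cyclic group divisible design of type 2^7 is weighted and filled. Types 2^13 and 3^5
  serve 26 and 15 points in the same way.\<close>

lemma holey_14:
  assumes "holey w 2"
  shows "holey w 14"
proof -
  have "diff_family (2 * 7) 7 [[0, 1, 4, 6]]" by code_simp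
  then show ?thesis using holey_cyclic_fill[OF dec4_blow_12_4, of 2 7] assms by simp
qed

lemma holey_26:
  assumes "holey w 2"
  shows "holey w 26"
proof -
  have "diff_family (2 * 13) 13 [[0, 1, 3, 9], [0, 4, 11, 16]]" by code_simp
  then show ?thesis using holey_cyclic_fill[OF dec4_blow_12_4, of 2 13] assms by simp
qed

lemma holey_15:
  assumes "holey w 3"
  shows "holey w 15"
proof -
  have "diff_family (3 * 5) 5 [[0, 1, 3, 7]]" by code_simp
  then show ?thesis using holey_cyclic_fill[OF dec4_blow_12_4, of 3 5] assms by simp
qed

text \<open>
  The translates in \<open>\<int>\<^sub>3\<^sup>3\<close>, with \<open>(x, y, z)\<close> encoded as \<open>9 x + 3 y + z\<close>, of
  \<open>{000, 010, 100, 111}\<close> and \<open>{000, 012, 121, 220}\<close>; they form a group divisible design whose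
  groups are the cosets of \<open>\<langle>001\<rangle>\<close>.
\<close>

definition z3_blocks :: "int list list" where
  "z3_blocks =
    [[0,3,9,13], [1,4,10,14], [2,5,11,12], [3,6,12,16], [4,7,13,17], [5,8,14,15], [6,0,15,10],
    [7,1,16,11], [8,2,17,9], [9,12,18,22], [10,13,19,23], [11,14,20,21], [12,15,21,25],
    [13,16,22,26], [14,17,23,24], [15,9,24,19], [16,10,25,20], [17,11,26,18], [18,21,0,4],
    [19,22,1,5], [20,23,2,3], [21,24,3,7], [22,25,4,8], [23,26,5,6], [24,18,6,1], [25,19,7,2],
    [26,20,8,0], [0,5,16,24], [1,3,17,25], [2,4,15,26], [3,8,10,18], [4,6,11,19], [5,7,9,20],
    [6,2,13,21], [7,0,14,22], [8,1,12,23], [9,14,25,6], [10,12,26,7], [11,13,24,8],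
    [12,17,19,0], [13,15,20,1], [14,16,18,2], [15,11,22,3], [16,9,23,4], [17,10,21,5],
    [18,23,7,15], [19,21,8,16], [20,22,6,17], [21,26,1,9], [22,24,2,10], [23,25,0,11],
    [24,20,4,12], [25,18,5,13], [26,19,3,14]]"

lemma holey_27:
  assumes g: "holey w 3"
  shows "holey w 27"
proof -
  let ?gs = "[[0,1,2], [3,4,5], [6,7,8], [9,10,11], [12,13,14], [15,16,17], [18,19,20], [21,22,23], [24,25,26]] :: int list list"
  have 1: "explicit_gdd 27 ?gs z3_blocks" unfolding z3_blocks_def by code_simp
  have 2: "msort (concat ?gs) = [0..27 - 1]" by code_simp
  have "holey w (nat 27)"
    by (rule holey_explicit_fill[OF dec4_blow_12_4 1 2]) (use g in \<open>auto simp: numeral_3_eq_3\<close>)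
  then show ?thesis by simp
qed

text \<open>
  The blocks are the triples of a cyclic Kirkman triple system on 15 points; six of its seven
  parallel classes are each extended by a new point, the seventh gives groups of size three.
\<close>

lemma holey_21:
  assumes g: "holey w 3" "holey w 6"
  shows "holey w 21"
proof -
  let ?gs = "[[15,16,17,18,19,20], [6,13,14], [0,1,3], [2,7,11], [4,10,12], [5,8,9]] :: int list list"
  have 1: "explicit_gdd 21 ?gs
    [[0,7,14,15], [1,2,4,15], [3,8,12,15], [5,11,13,15], [6,9,10,15], [1,8,14,16], [2,3,5,16],
    [4,9,13,16], [6,12,7,16], [0,10,11,16], [2,9,14,17], [3,4,6,17], [5,10,7,17], [0,13,8,17],
    [1,11,12,17], [3,10,14,18], [4,5,0,18], [6,11,8,18], [1,7,9,18], [2,12,13,18], [4,11,14,19],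
    [5,6,1,19], [0,12,9,19], [2,8,10,19], [3,13,7,19], [5,12,14,20], [6,0,2,20], [1,13,10,20],
    [3,9,11,20], [4,7,8,20]]"
    by code_simp
  have 2: "msort (concat ?gs) = [0..21 - 1]" by code_simp
  have "holey w (nat 21)"
    by (rule holey_explicit_fill[OF dec4_blow_12_4 1 2])
      (use g in \<open>auto simp: numeral_3_eq_3 eval_nat_numeral\<close>)
  then show ?thesis by simp
qed

text \<open>The translates in the group of pairs modulo 5, with (a, b) coded as 5 a + b, of {00, 01,
  10, 22} and of its double {00, 02, 20, 44}. The hole is the point 11; three translates of each
  base block partition the rest.\<close>

lemma holey_1_2: "holey 1 2"
proof -
  let ?ps = "[[0,1,5,12], [2,3,7,14], [10,11,15,22], [19,16,4,13], [23,20,8,17], [24,21,9,18]] :: int list list"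
  have "explicit_gdd 25 [[6]] (?ps @
    [[1,2,6,13], [3,4,8,10], [4,0,9,11], [5,6,10,17], [6,7,11,18], [7,8,12,19], [8,9,13,15],
    [9,5,14,16], [11,12,16,23], [12,13,17,24], [13,14,18,20], [14,10,19,21], [15,16,20,2],
    [16,17,21,3], [17,18,22,4], [18,19,23,0], [19,15,24,1], [20,21,0,7], [21,22,1,8],
    [22,23,2,9], [23,24,3,5], [24,20,4,6], [0,2,10,24], [1,3,11,20], [2,4,12,21], [3,0,13,22],
    [4,1,14,23], [5,7,15,4], [6,8,16,0], [7,9,17,1], [8,5,18,2], [9,6,19,3], [10,12,20,9],
    [11,13,21,5], [12,14,22,6], [13,10,23,7], [14,11,24,8], [15,17,0,14], [16,18,1,10],
    [17,19,2,11], [18,15,3,12], [20,22,5,19], [21,23,6,15], [22,24,7,16]])"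
    "msort ([6] @ concat ?ps) = [0..25 - 1]"
    by code_simp+
  from holey_explicit[OF this(1) _ this(2)] show ?thesis by simp
qed

text \<open>The affine plane of order 4: the translates of {0, 1, 3, 7} modulo 15, and the cosets of
  {0, 5, 10} completed by the point 15. The translates by 1, 6 and 11 are parallel to the
  hole.\<close>

lemma holey_4_1: "holey 4 1"
proof -
  let ?ps = "[[1,2,4,8], [6,7,9,13], [11,12,14,3]] :: int list list"
  have "explicit_gdd 16 [[0, 5, 10, 15]] (?ps @
    [[0,1,3,7], [2,3,5,9], [3,4,6,10], [4,5,7,11], [5,6,8,12], [7,8,10,14], [8,9,11,0],
    [9,10,12,1], [10,11,13,2], [12,13,0,4], [13,14,1,5], [14,0,2,6], [1,6,11,15], [2,7,12,15],
    [3,8,13,15], [4,9,14,15]])"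
    "msort ([0, 5, 10, 15] @ concat ?ps) = [0..16 - 1]"
    by code_simp+
  from holey_explicit[OF this(1) _ this(2)] show ?thesis by simp
qed

text \<open>The groups of the design \<open>z3_blocks\<close> are completed by the new point 27, and
  one completed group is the hole. The partition consists of one orbit under translation by 001 for
  each of the two base blocks.\<close>

lemma holey_4_2: "holey 4 2"
proof -
  let ?ps = "[[0,5,16,24], [1,3,17,25], [2,4,15,26], [9,12,18,22], [10,13,19,23], [11,14,20,21]] :: int list list"
  have "explicit_gdd 28 [[6,7,8,27]] (z3_blocks @
    [[0,1,2,27], [3,4,5,27], [9,10,11,27], [12,13,14,27], [15,16,17,27], [18,19,20,27],
    [21,22,23,27], [24,25,26,27]])"
    "set ?ps \<subseteq> set (z3_blocks @
    [[0,1,2,27], [3,4,5,27], [9,10,11,27], [12,13,14,27], [15,16,17,27], [18,19,20,27],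
    [21,22,23,27], [24,25,26,27]])"
    "msort ([6,7,8,27] @ concat ?ps) = [0..28 - 1]"
    unfolding z3_blocks_def by code_simp+
  from holey_explicit[OF this] show ?thesis by simp
qed

section \<open>Recursion and counting\<close>

text \<open>The extra value \<open>m = 9\<close> serves \<open>t\<close> equal to 41, 42, 43 and 45,
  which have no other admissible \<open>m\<close>.\<close>

lemma holey_split:
  assumes "4 * m + u = t" "u \<le> m" "m mod 4 \<noteq> 2 \<and> m mod 3 \<noteq> 0 \<or> m = 9" "m > 0"
    and "holey w m" "holey w u"
  shows "holey w t"
proof -
  have "oa 5 m" using assms(3,4) oa_5 oa_5_9 by blast
  then show ?thesis
    using holey_truncated[OF _ assms(2,5,6) dec4_blow_12_4 dec4_blow_12_5] assms(1) by simp
qed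

text \<open>The bounds \<open>u \<noteq> 1\<close> and \<open>m > 1\<close> keep the recursion away
  from \<open>t = 1\<close>. For \<open>w = 1\<close> that is \<open>v = 13\<close>, the projective
  plane of order 3, in which any two blocks meet.\<close>

definition admissible :: "nat \<Rightarrow> nat \<Rightarrow> bool" where
  "admissible m u \<longleftrightarrow> u \<le> m \<and> u \<noteq> 1 \<and> m > 1 \<and> (m mod 4 \<noteq> 2 \<and> m mod 3 \<noteq> 0 \<or> m = 9)"

text \<open>The excluded values are exactly those without an admissible split. Below 72 this is a
  finite check; from 72 on there is room to choose among three consecutive values of
  \<open>m\<close>.\<close>

lemma split_exists:
  assumes "t \<notin> set ([0..<16] @ [17, 21, 26, 27, 29])"
  shows "\<exists>m u. t = 4 * m + u \<and> admissible m u"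
proof (cases "t < 72")
  case True
  have "\<forall>t\<in>set [0..<72]. t \<notin> set ([0..<16] @ [17, 21, 26, 27, 29]) \<longrightarrow>
      (\<exists>m\<in>set [4..<18]. 4 * m \<le> t \<and> admissible m (t - 4 * m))"
    unfolding admissible_def by code_simp
  moreover have "t \<in> set [0..<72]" using True by simp
  ultimately obtain m where "4 * m \<le> t" "admissible m (t - 4 * m)" using assms by blast
  then show ?thesis by (intro exI[of _ m] exI[of _ "t - 4 * m"]) simp
next
  case False
  \<comment> \<open>With \<open>m = r + d\<close> and \<open>d\<close> from 1 to 3, the rest
    \<open>t - 4 * m\<close> lies between 4 and 15. As \<open>m \<ge> 15\<close>, it is at most
    \<open>m\<close>, and it is not 1.\<close>
  define r where "r = t div 4 - 4"
  have r: "r \<ge> 14" using False by (simp add: r_def)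
  \<comment> \<open>Among three consecutive numbers one is divisible by 3 and at most one is 2
    modulo 4, so one is left.\<close>
  have "\<exists>d\<in>{1, 2, 3}. (r + d) mod 4 \<noteq> 2 \<and> (r + d) mod 3 \<noteq> 0"
  proof (rule ccontr)
    assume "\<not> ?thesis"
    then have "(r + 1) mod 4 = 2 \<or> (r + 1) mod 3 = 0" "(r + 2) mod 4 = 2 \<or> (r + 2) mod 3 = 0"
      "(r + 3) mod 4 = 2 \<or> (r + 3) mod 3 = 0" by auto
    then show False by presburger
  qed
  then obtain d where "d \<in> {1, 2, 3}" and d': "(r + d) mod 4 \<noteq> 2" "(r + d) mod 3 \<noteq> 0" by blast
  then have d: "1 \<le> d" "d \<le> 3" by auto
  have t: "t div 4 = r + 4" using False by (simp add: r_def)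
  have "4 * (t div 4) \<le> t" "t \<le> 4 * (t div 4) + 3" by presburger+
  then have "4 * (r + d) + 4 \<le> t" and "t \<le> 4 * (r + d) + 15" using d unfolding t by simp_all
  then have "t = 4 * (r + d) + (t - 4 * (r + d)) \<and> admissible (r + d) (t - 4 * (r + d))"
    using r d d' by (auto simp: admissible_def)
  then show ?thesis by blast
qed

lemma holey_from_base:
  assumes base: "\<And>t. t \<in> set ([0..<16] @ [17, 21, 26, 27, 29]) \<Longrightarrow> t \<noteq> 1 \<Longrightarrow> holey w t"
    and "t \<noteq> 1"
  shows "holey w t"
  using assms(2)
proof (induction t rule: less_induct)
  case (less t)
  show ?case
  proof (cases "t \<in> set ([0..<16] @ [17, 21, 26, 27, 29])")
    case True then show ?thesis using base less.prems by blast
  next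
    case False
    then obtain m u where mu: "t = 4 * m + u" "admissible m u" using split_exists by blast
    then have "m < t" "u < t" "m \<noteq> 1" "u \<noteq> 1" by (auto simp: admissible_def)
    then have "holey w m" "holey w u" using less.IH by blast+
    then show ?thesis using holey_split[of m u t w] mu by (auto simp: admissible_def)
  qed
qed

lemma base_cases:
  assumes "(t :: nat) \<in> set ([0..<16] @ [17, 21, 26, 27, 29])"
  shows "t \<in> {0,1,2,3,4,5,6,7,8,9,10,11,12,13,14,15,17,21,26,27,29}"
proof -
  have "set ([0..<16] @ [17, 21, 26, 27, 29]) = {0,1,2,3,4,5,6,7,8,9,10,11,12,13,14,15,17,21,26,27,29}"
    by code_simp
  then show ?thesis using assms by blast
qed

lemma holey_1: "t \<noteq> 1 \<Longrightarrow> holey 1 t"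
proof (rule holey_from_base)
  fix t assume t: "t \<in> set ([0..<16] @ [17, 21, 26, 27, 29])" "t \<noteq> 1"
  show "holey 1 t"
    using base_cases[OF t(1)] t(2)
    by (elim insertE emptyE; simp only:)
      (rule holey_0 holey_1_2 holey_1_3 holey_1_4 holey_1_5 holey_1_6 holey_1_7 holey_1_8 holey_1_9 holey_1_10
        holey_1_11 holey_1_12 holey_1_13 holey_14[OF holey_1_2] holey_15[OF holey_1_3]
        holey_1_17 holey_21[OF holey_1_3 holey_1_6] holey_26[OF holey_1_2] holey_27[OF holey_1_3] holey_1_29)+
qed

lemma holey_4: "holey 4 t"
proof (cases "t = 1")
  case False
  \<comment> \<open>The splits 4 * 4 + 1 and 4 * 7 + 1 are available for \<open>w = 4\<close>, where
    \<open>holey 4 1\<close> holds; for \<open>w = 1\<close> these two values come from difference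
    families.\<close>
  have 17: "holey 4 17" using holey_split[of 4 1 17 4] holey_4_1 holey_4_4 by simp
  have 29: "holey 4 29" using holey_split[of 7 1 29 4] holey_4_1 holey_4_7 by simp
  show ?thesis
  proof (rule holey_from_base[OF _ False])
    fix t assume t: "t \<in> set ([0..<16] @ [17, 21, 26, 27, 29])" "t \<noteq> 1"
    show "holey 4 t"
      using base_cases[OF t(1)] t(2)
      by (elim insertE emptyE; simp only:)
        (rule holey_0 holey_4_2 holey_4_3 holey_4_4 holey_4_5 holey_4_6 holey_4_7 holey_4_8 holey_4_9 holey_4_10
          holey_4_11 holey_4_12 holey_4_13 holey_14[OF holey_4_2] holey_15[OF holey_4_3]
          17 holey_21[OF holey_4_3 holey_4_6] holey_26[OF holey_4_2] holey_27[OF holey_4_3] 29)+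
  qed
qed (simp only: holey_4_1)

section \<open>Counting ordered pairs and the final Steiner systems\<close>

lemma card_clique: "finite V \<Longrightarrow> card (clique V) = card V * (card V - 1)"
proof -
  assume V: "finite V"
  have "clique V = V \<times> V - (\<lambda>x. (x, x)) ` V" by (auto simp: clique_def)
  then have "card (clique V) = card V * card V - card ((\<lambda>x. (x, x)) ` V)"
    using V by (simp add: card_Diff_subset image_subset_iff card_cartesian_product)
  also have "card ((\<lambda>x. (x, x)) ` V) = card V" by (rule card_image) (simp add: inj_on_def)
  finally show ?thesis by (simp add: right_diff_distrib')
qed

lemma card_cliques:
  assumes "finite \<B>" "\<And>b. b \<in> \<B> \<Longrightarrow> card b = 4" "disjoint_family_on clique \<B>"
  shows "card (\<Union>b\<in>\<B>. clique b) = 12 * card \<B>"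
proof -
  have fin: "finite b" if "b \<in> \<B>" for b using assms(2)[OF that] card.infinite by fastforce
  then have "card (\<Union>b\<in>\<B>. clique b) = (\<Sum>b\<in>\<B>. card (clique b))"
    using assms by (intro card_UN_disjoint) (auto simp: disjoint_family_on_def clique_def intro: finite_subset[of _ "b \<times> b" for b])
  also have "\<dots> = (\<Sum>b\<in>\<B>. 12)" using fin assms(2) by (intro sum.cong) (simp_all add: card_clique)
  finally show ?thesis by simp
qed

lemma packing_disjoint:
  assumes p: "packing v 4 \<B>"
  shows "finite \<B>" "disjoint_family_on clique \<B>"
proof -
  have "\<B> \<subseteq> Pow {..<v}" using p by (auto simp: packing_def)
  then show f: "finite \<B>" by (rule finite_subset) simp
  show "disjoint_family_on clique \<B>"
    unfolding disjoint_family_on_def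
  proof (intro ballI impI equals0I)
    fix b c z assume bc: "b \<in> \<B>" "c \<in> \<B>" "b \<noteq> c" "z \<in> clique b \<inter> clique c"
    obtain x y where z: "z = (x, y)" by (cases z)
    have m: "x \<in> b" "y \<in> b" "x \<in> c" "y \<in> c" "x \<noteq> y" using bc z by auto
    then have "x < v" "y < v" using p bc(1) unfolding packing_def by blast+
    then have "card {B\<in>\<B>. x \<in> B \<and> y \<in> B} \<le> 1" using p m by (simp add: packing_def)
    moreover have "card {b, c} \<le> card {B\<in>\<B>. x \<in> B \<and> y \<in> B}"
      by (rule card_mono) (use f bc m in auto)
    ultimately show False using bc(3) by simp
  qed
qed

lemma packing_card:
  assumes p: "packing v 4 \<B>"
  shows "12 * card \<B> \<le> v * (v - 1)"
proof -
  have b: "\<And>b. b \<in> \<B> \<Longrightarrow> b \<subseteq> {..<v} \<and> card b = 4" using p by (simp add: packing_def)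
  have "12 * card \<B> = card (\<Union>b\<in>\<B>. clique b)"
    using card_cliques[OF packing_disjoint(1)[OF p] _ packing_disjoint(2)[OF p]] b by simp
  also have "\<dots> \<le> card (clique {..<v})"
    using b by (intro card_mono) (auto simp: clique_def intro: finite_subset[of _ "{..<v} \<times> {..<v}"])
  also have "\<dots> = v * (v - 1)" by (simp add: card_clique)
  finally show ?thesis .
qed

lemma decomp_packing:
  assumes d: "decomp {4} (clique {..<v}) \<B>"
  shows "packing v 4 \<B>" "12 * card \<B> = v * (v - 1)"
proof -
  have b: "b \<subseteq> {..<v} \<and> card b = 4" if "b \<in> \<B>" for b
    using decomp4_subset[OF d, of "{..<v}"] decompD(1)[OF d that] that by (auto simp: clique_def)
  have "card {B\<in>\<B>. x \<in> B \<and> y \<in> B} \<le> 1" if "x \<noteq> y" for x y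
  proof (cases "{B\<in>\<B>. x \<in> B \<and> y \<in> B} = {}")
    case False
    then obtain c where "c \<in> \<B>" "x \<in> c" "y \<in> c" by blast
    then have "{B\<in>\<B>. x \<in> B \<and> y \<in> B} \<subseteq> {c}" using decompD(5)[OF d] that by blast
    then show ?thesis by (metis card.empty card_insert_disjoint card_mono empty_iff finite.emptyI finite_insert One_nat_def)
  next
    case True then show ?thesis by (simp only: card.empty)
  qed
  then show p: "packing v 4 \<B>" using b by (simp add: packing_def)
  have "12 * card \<B> = card (\<Union>b\<in>\<B>. clique b)"
    using card_cliques[OF packing_disjoint(1)[OF p] _ packing_disjoint(2)[OF p]] b by simp
  also have "\<dots> = card (clique {..<v})" using d by (simp add: decomp_def)
  finally show "12 * card \<B> = v * (v - 1)" by (simp add: card_clique)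
qed

lemma ppc_card:
  assumes p: "packing v 4 \<B>" and P: "ppc \<B> P"
  shows "card (\<Union>P) = 4 * card P" "4 * card P \<le> v"
proof -
  have b: "b \<subseteq> {..<v} \<and> card b = 4 \<and> finite b" if "b \<in> P" for b
    using p P that finite_subset[of b "{..<v}"] by (auto simp: packing_def ppc_def)
  have "card (\<Union>P) = (\<Sum>b\<in>P. card b)"
    by (rule card_Union_disjoint) (use P b in \<open>auto simp: ppc_def pairwise_def disjnt_def\<close>)
  then show e: "card (\<Union>P) = 4 * card P" using b by simp
  have "card (\<Union>P) \<le> card {..<v}" using b by (intro card_mono) auto
  then show "4 * card P \<le> v" using e by simp
qed

text \<open>A one-point hole contains no pair and is the only point missed. A four-point hole
  becomes a block of the system and of the class, so no point is missed.\<close>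

lemma steiner_with_near_parallel_class:
  assumes "v mod 12 = 1 \<or> v mod 12 = 4" and "v \<noteq> 13"
  shows "\<exists>\<B> P. decomp {4} (clique {..<v}) \<B> \<and> ppc \<B> P \<and> v < card (\<Union>P) + 4"
proof -
  define t where "t = v div 12"
  from assms(1) show ?thesis
  proof
    assume "v mod 12 = 1"
    then have v: "v = 12 * t + 1" by (simp add: t_def) presburger
    then have "holey 1 t" using holey_1 assms(2) by auto
    then obtain \<B> P where "holey_design {..<v} {..<1} (\<B> :: nat set set) P" by (auto simp: holey_def v)
    then have n: "decomp {4} (clique {..<v} - clique {..<1}) \<B>" "P \<subseteq> \<B>" "disjoint P" "\<Union>P = {..<v} - {..<1}"
      by (simp_all add: holey_design_def)
    have "clique {..<1 :: nat} = {}" by auto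
    with n have "decomp {4} (clique {..<v}) \<B>" "ppc \<B> P" "card (\<Union>P) = v - 1"
      by (simp_all add: ppc_def disjoint_def card_Diff_subset v)
    then show ?thesis by (intro exI[of _ \<B>] exI[of _ P]) simp
  next
    assume "v mod 12 = 4"
    then have v: "v = 12 * t + 4" by (simp add: t_def) presburger
    obtain \<B> P where "holey_design {..<v} {..<4} (\<B> :: nat set set) P" using holey_4[of t] by (auto simp: holey_def v)
    then have n: "decomp {4} (clique {..<v} - clique {..<4}) \<B>" "P \<subseteq> \<B>" "disjoint P" "\<Union>P = {..<v} - {..<4}"
      by (simp_all add: holey_design_def)
    have "decomp {4} (clique {..<4 :: nat}) {{..<4}}"
      by (simp add: decomp_def disjoint_family_on_def)
    from decomp_Un[OF n(1) this] have "decomp {4} (clique {..<v} - clique {..<4} \<union> clique {..<4}) (\<B> \<union> {{..<4}})"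
      by blast
    moreover have "clique {..<v} - clique {..<4} \<union> clique {..<4} = clique {..<v}"
      using v by (intro Un_absorb2 Diff_partition[THEN trans[OF Un_commute]] clique_mono) auto
    moreover have "ppc (\<B> \<union> {{..<4}}) (insert {..<4} P)"
    proof -
      have "b \<inter> {..<4} = {}" if "b \<in> P" for b using n(4) that by blast
      then show ?thesis using n(2,3) by (auto simp: ppc_def disjoint_def)
    qed
    moreover have "\<Union>(insert {..<4} P) = {..<v}" using n(4) v by auto
    ultimately show ?thesis
      by (intro exI[of _ "\<B> \<union> {{..<4}}"] exI[of _ "insert {..<4} P"]) simp
  qed
qed

theorem theorem4p7:
  fixes v :: nat
  assumes "v \<ge> 4" and "v mod 12 = 1 \<or> v mod 12 = 4" and "v \<noteq> 13"
  shows "beta (v div 4) v 4 = v * (v - 1) div 12"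
proof -
  obtain \<B> P where d: "decomp {4} (clique {..<v}) \<B>" and P: "ppc \<B> P" "v < card (\<Union>P) + 4"
    using steiner_with_near_parallel_class assms by blast
  note p = decomp_packing[OF d]
  \<comment> \<open>This is forced by \<open>4 * card P \<le> v < 4 * card P + 4\<close>.\<close>
  have "card P = v div 4" using ppc_card[OF p(1) P(1)] P(2) by linarith
  moreover have "card Q \<noteq> v div 4 + 1" if "ppc \<B> Q" for Q
    using ppc_card(2)[OF p(1) that] by linarith
  ultimately have m: "max_ppc_size \<B> (v div 4)"
    using P(1) unfolding max_ppc_size_def by blast
  have c: "card \<B> = v * (v - 1) div 12" using p(2) by (simp flip: p(2))
  show ?thesis
    unfolding beta_def
  proof (rule Greatest_equality)
    show "\<exists>\<B>. packing v 4 \<B> \<and> max_ppc_size \<B> (v div 4) \<and> card \<B> = v * (v - 1) div 12"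
      using p(1) m c by blast
    fix n assume "\<exists>\<B>. packing v 4 \<B> \<and> max_ppc_size \<B> (v div 4) \<and> card \<B> = n"
    then have "12 * n \<le> v * (v - 1)" using packing_card by blast
    then show "n \<le> v * (v - 1) div 12" by (simp add: less_eq_div_iff_mult_less_eq mult.commute)
  qed
qed

end
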